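(* Let $M$ be an irreducible based module of rank $5$ over the complex representation ring $r(S_4)$ of the symmetric group $S_4$. Then $M$ is equivalent to one of the following based modules $M_{5,1},M_{5,2}$, given by the matrices of $V_\psi,V_{\rho_1},V_{\rho_2}$ (with $V_{\rho_3}=V_\psi V_{\rho_2}$ acting by the product of the matrices of $V_\psi$ and $V_{\rho_2}$): $M_{5,1}$: $V_\psi\mapsto\begin{pmatrix}0&1&0&0&0\\1&0&0&0&0\\0&0&0&1&0\\0&0&1&0&0\\0&0&0&0&1\end{pmatrix}$, $V_{\rho_1}\mapsto\begin{pmatrix}0&0&0&0&1\\0&0&0&0&1\\0&0&1&1&0\\0&0&1&1&0\\1&1&0&0&1\end{pmatrix}$, $V_{\rho_2}\mapsto\begin{pmatrix}0&0&0&1&0\\0&0&1&0&0\\0&1&1&1&1\\1&0&1&1&1\\0&0&1&1&0\end{pmatrix}$; $M_{5,2}$: $V_\psi\mapsto\begin{pmatrix}0&1&0&0&0\\1&0&0&0&0\\0&0&0&1&0\\0&0&1&0&0\\0&0&0&0&1\end{pmatrix}$, $V_{\rho_1}\mapsto\begin{pmatrix}1&1&0&0&0\\1&1&0&0&0\\0&0&1&1&0\\0&0&1&1&0\\0&0&0&0&2\end{pmatrix}$, $V_{\rho_2}\mapsto\begin{pmatrix}0&0&0&1&1\\0&0&1&0&1\\0&1&0&0&1\\1&0&0&0&1\\1&1&1&1&1\end{pmatrix}$.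
   Context: The ring $r(S_4)$ is the Grothendieck ring of finite-dimensional complex representations of $S_4$. It is commutative and free over $\mathbb{Z}$ with basis $\{1,V_\psi,V_{\rho_1},V_{\rho_2},V_{\rho_3}\}$, the classes of the irreducible representations: trivial, sign, the 2-dimensional one, the 3-dimensional standard one, and $V_{\rho_3}=V_\psi V_{\rho_2}$. The products are determined by $V_\psi^2=1$, $V_\psi V_{\rho_1}=V_{\rho_1}$, $V_\psi V_{\rho_2}=V_{\rho_3}$, $V_{\rho_1}^2=1+V_\psi+V_{\rho_1}$, $V_{\rho_1}V_{\rho_2}=V_{\rho_2}+V_{\rho_3}$, $V_{\rho_2}^2=1+V_{\rho_1}+V_{\rho_2}+V_{\rho_3}$. All basis elements are self-dual. A $\mathbb{Z}_+$-module over $r(S_4)$ is an $r(S_4)$-module $M$ (with $1$ acting as identity) together with a fixed $\mathbb{Z}$-basis in which each basis element of $r(S_4)$ acts by a matrix with non-negative integer entries. Its rank is the size of the basis. It is a based module if, moreover, the matrix of each basis element of $r(S_4)$ is symmetric (this is the general condition $a_{il}^k=a_{i^*k}^l$ on structure constants $b_i m_l=\sum_k a_{il}^k m_k$, since here $i^*=i$). It is irreducible if it is nonzero and no nonempty proper subset of the fixed basis spans an $r(S_4)$-submodule. Two $\mathbb{Z}_+$-modules are equivalent if some bijection between their fixed bases induces an isomorphism of $r(S_4)$-modules, i.e. the representing matrices are simultaneously conjugate by a permutation matrix. *)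

theory Defs
  imports "HOL-Analysis.Analysis" "HOL-Combinatorics.Permutations"
begin

section \<open>The representation ring of the symmetric group on four letters\<close>

text \<open>
  The five irreducible complex representations: trivial, sign, the two-dimensional one, the
  standard three-dimensional one, and the product of the last one with the sign.
\<close>

datatype irrep = Triv | Psi | Rho1 | Rho2 | Rho3

lemma UNIV_irrep: "UNIV = {Triv, Psi, Rho1, Rho2, Rho3}"
  using irrep.exhaust by auto

instance irrep :: finite
  by standard (simp add: UNIV_irrep)

lemma sum_irrep: "(\<Sum>i\<in>UNIV. f i) = f Triv + f Psi + f Rho1 + f Rho2 + (f Rho3 :: 'a::comm_monoid_add)"
  by (simp add: UNIV_irrep add.assoc)

lemma all_irrep: "(\<forall>i. P i) \<longleftrightarrow> P Triv \<and> P Psi \<and> P Rho1 \<and> P Rho2 \<and> P Rho3"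
  by (metis irrep.exhaust)

text \<open>
  The irreducible constituents, with multiplicity, of the tensor product of two irreducible
  representations.  \<open>character_tensor\<close> and \<open>character_orthonormal\<close> below verify that this
  is the decomposition of products of the irreducible characters.
\<close>

fun constituents :: "irrep \<Rightarrow> irrep \<Rightarrow> irrep list" where
  "constituents Triv j = [j]"
| "constituents i Triv = [i]"
| "constituents Psi Psi = [Triv]"
| "constituents Psi Rho1 = [Rho1]"
| "constituents Rho1 Psi = [Rho1]"
| "constituents Psi Rho2 = [Rho3]"
| "constituents Rho2 Psi = [Rho3]"
| "constituents Psi Rho3 = [Rho2]"
| "constituents Rho3 Psi = [Rho2]"
| "constituents Rho1 Rho1 = [Triv, Psi, Rho1]"
| "constituents Rho1 Rho2 = [Rho2, Rho3]"
| "constituents Rho2 Rho1 = [Rho2, Rho3]"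
| "constituents Rho1 Rho3 = [Rho2, Rho3]"
| "constituents Rho3 Rho1 = [Rho2, Rho3]"
| "constituents Rho2 Rho2 = [Triv, Rho1, Rho2, Rho3]"
| "constituents Rho2 Rho3 = [Psi, Rho1, Rho2, Rho3]"
| "constituents Rho3 Rho2 = [Psi, Rho1, Rho2, Rho3]"
| "constituents Rho3 Rho3 = [Triv, Rho1, Rho2, Rho3]"

text \<open>
  The Grothendieck ring: the free abelian group on the irreducible representations (an element
  is its family of coefficients), multiplied by the bilinear extension of the tensor product.
  The class of the irreducible representation \<open>i\<close> is \<open>V i\<close> below.
\<close>

typedef rS4 = "UNIV :: (irrep \<Rightarrow> int) set"
  morphisms rS4_coeff Abs_rS4 ..

setup_lifting type_definition_rS4

lemma constituents_comm: "count_list (constituents i j) k = count_list (constituents j i) k"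
  by (cases i; cases j) simp_all

lemma constituents_assoc:
  "(\<Sum>m\<in>UNIV. count_list (constituents i j) m * count_list (constituents m k) l) =
   (\<Sum>m\<in>UNIV. count_list (constituents i m) l * count_list (constituents j k) m)"
  by (cases i; cases j; cases k; cases l) (simp_all add: sum_irrep)

instantiation rS4 :: comm_ring_1
begin

lift_definition zero_rS4 :: rS4 is "\<lambda>_. 0" .
lift_definition one_rS4 :: rS4 is "\<lambda>k. if k = Triv then 1 else 0" .
lift_definition plus_rS4 :: "rS4 \<Rightarrow> rS4 \<Rightarrow> rS4" is "\<lambda>x y k. x k + y k" .
lift_definition uminus_rS4 :: "rS4 \<Rightarrow> rS4" is "\<lambda>x k. - x k" .
lift_definition minus_rS4 :: "rS4 \<Rightarrow> rS4 \<Rightarrow> rS4" is "\<lambda>x y k. x k - y k" .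
lift_definition times_rS4 :: "rS4 \<Rightarrow> rS4 \<Rightarrow> rS4" is
  "\<lambda>x y k. \<Sum>i\<in>UNIV. \<Sum>j\<in>UNIV. x i * y j * int (count_list (constituents i j) k)" .

instance
proof
  fix a b c :: rS4
  show "a * b * c = a * (b * c)"
  proof (transfer, rule ext)
    fix x y z :: "irrep \<Rightarrow> int" and l
    let ?N = "\<lambda>i j k. int (count_list (constituents i j) k)"
    have "(\<Sum>m\<in>UNIV. \<Sum>k\<in>UNIV. (\<Sum>i\<in>UNIV. \<Sum>j\<in>UNIV. x i * y j * ?N i j m) * z k * ?N m k l) =
          (\<Sum>m\<in>UNIV. \<Sum>k\<in>UNIV. \<Sum>i\<in>UNIV. \<Sum>j\<in>UNIV. x i * y j * z k * (?N i j m * ?N m k l))"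
      by (simp add: sum_distrib_left sum_distrib_right mult_ac)
    also have "\<dots> = (\<Sum>k\<in>UNIV. \<Sum>i\<in>UNIV. \<Sum>j\<in>UNIV. \<Sum>m\<in>UNIV. x i * y j * z k * (?N i j m * ?N m k l))"
      by (rule trans[OF sum.swap], rule sum.cong[OF refl], rule trans[OF sum.swap],
          rule sum.cong[OF refl], rule sum.swap)
    also have "\<dots> = (\<Sum>k\<in>UNIV. \<Sum>i\<in>UNIV. \<Sum>j\<in>UNIV. x i * y j * z k * (\<Sum>m\<in>UNIV. ?N i m l * ?N j k m))"
      using constituents_assoc[THEN arg_cong[where f = int]]
      by (simp flip: sum_distrib_left)
    also have "\<dots> = (\<Sum>k\<in>UNIV. \<Sum>i\<in>UNIV. \<Sum>j\<in>UNIV. \<Sum>m\<in>UNIV. x i * y j * z k * (?N i m l * ?N j k m))"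
      by (simp add: sum_distrib_left)
    also have "\<dots> = (\<Sum>i\<in>UNIV. \<Sum>m\<in>UNIV. \<Sum>j\<in>UNIV. \<Sum>k\<in>UNIV. x i * y j * z k * (?N i m l * ?N j k m))"
      by (rule trans[OF sum.swap], rule sum.cong[OF refl], rule trans[OF sum.cong[OF refl sum.swap]],
          rule trans[OF sum.swap], rule sum.cong[OF refl], rule sum.swap)
    also have "\<dots> = (\<Sum>i\<in>UNIV. \<Sum>m\<in>UNIV. x i * (\<Sum>j\<in>UNIV. \<Sum>k\<in>UNIV. y j * z k * ?N j k m) * ?N i m l)"
      by (simp add: sum_distrib_left sum_distrib_right mult_ac)
    finally show "(\<Sum>m\<in>UNIV. \<Sum>k\<in>UNIV. (\<Sum>i\<in>UNIV. \<Sum>j\<in>UNIV. x i * y j * ?N i j m) * z k * ?N m k l) =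
       (\<Sum>i\<in>UNIV. \<Sum>m\<in>UNIV. x i * (\<Sum>j\<in>UNIV. \<Sum>k\<in>UNIV. y j * z k * ?N j k m) * ?N i m l)" .
  qed
  show "a * b = b * a"
  proof (transfer, rule ext)
    fix x y :: "irrep \<Rightarrow> int" and k
    show "(\<Sum>i\<in>UNIV. \<Sum>j\<in>UNIV. x i * y j * int (count_list (constituents i j) k)) =
          (\<Sum>i\<in>UNIV. \<Sum>j\<in>UNIV. y i * x j * int (count_list (constituents i j) k))"
      by (subst sum.swap) (simp add: constituents_comm mult_ac)
  qed
  show "1 * a = a"
    by transfer (simp add: fun_eq_iff all_irrep sum_irrep)
  show "(a + b) * c = a * c + b * c"
    by transfer (simp add: fun_eq_iff all_irrep sum_irrep algebra_simps)
  show "(0::rS4) \<noteq> 1"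
    by transfer (auto simp: fun_eq_iff)
qed (transfer; simp add: fun_eq_iff)+

end

lift_definition V :: "irrep \<Rightarrow> rS4" is "\<lambda>i k. if k = i then 1 else 0" .

lemma rS4_eqI: "(\<And>k. rS4_coeff x k = rS4_coeff y k) \<Longrightarrow> x = y"
  by transfer auto

lemmas rS4_coeff_simps [simp] =
  zero_rS4.rep_eq one_rS4.rep_eq plus_rS4.rep_eq uminus_rS4.rep_eq minus_rS4.rep_eq V.rep_eq

lemma rS4_coeff_mult: "rS4_coeff (x * y) k =
    (\<Sum>i\<in>UNIV. \<Sum>j\<in>UNIV. rS4_coeff x i * rS4_coeff y j * int (count_list (constituents i j) k))"
  by transfer rule

lemma rS4_coeff_of_nat [simp]: "rS4_coeff (of_nat n) k = (if k = Triv then int n else 0)"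
  by (induction n) auto

lemma rS4_coeff_of_int [simp]: "rS4_coeff (of_int n) k = (if k = Triv then n else 0)"
  by (cases n rule: int_cases2) auto

lemma V_Triv: "V Triv = 1"
  by (rule rS4_eqI) simp

lemma V_mult: "V i * V j = (\<Sum>k\<leftarrow>constituents i j. V k)"
proof -
  have "\<forall>i j k. rS4_coeff (V i * V j) k = rS4_coeff (\<Sum>k\<leftarrow>constituents i j. V k) k"
    by (simp add: all_irrep rS4_coeff_mult sum_irrep)
  then show ?thesis by (blast intro: rS4_eqI)
qed

lemma V_products:
  "V Psi * V Psi = 1"
  "V Psi * V Rho1 = V Rho1"
  "V Psi * V Rho2 = V Rho3"
  "V Rho1 * V Rho1 = 1 + V Psi + V Rho1"
  "V Rho1 * V Rho2 = V Rho2 + V Rho3"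
  "V Rho2 * V Rho2 = 1 + V Rho1 + V Rho2 + V Rho3"
  by (simp_all add: V_mult V_Triv add.assoc)

lemma rS4_expand: "x = (\<Sum>i\<in>UNIV. of_int (rS4_coeff x i) * V i)"
proof -
  have "\<forall>k. rS4_coeff x k = rS4_coeff (\<Sum>i\<in>UNIV. of_int (rS4_coeff x i) * V i) k"
    by (simp add: all_irrep rS4_coeff_mult sum_irrep)
  then show ?thesis by (blast intro: rS4_eqI)
qed

text \<open>
  The irreducible characters.  The permutation representation on the four letters is the sum of
  the trivial and the standard one; the permutation representation on the three ways of
  splitting the letters into two pairs is the sum of the trivial and the two-dimensional one.
  The values are real, so no complex conjugation is needed in the inner product of characters.
\<close>

definition splittings :: "nat set set set" where
  "splittings = {{{0, 1}, {2, 3}}, {{0, 2}, {1, 3}}, {{0, 3}, {1, 2}}}"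

fun character :: "irrep \<Rightarrow> (nat \<Rightarrow> nat) \<Rightarrow> int" where
  "character Triv p = 1"
| "character Psi p = sign p"
| "character Rho1 p = int (card {s \<in> splittings. (`) ((`) p) s = s}) - 1"
| "character Rho2 p = int (card {i \<in> {..<4}. p i = i}) - 1"
| "character Rho3 p = sign p * (int (card {i \<in> {..<4}. p i = i}) - 1)"

definition perm4 :: "nat \<Rightarrow> nat \<Rightarrow> nat \<Rightarrow> nat \<Rightarrow> nat" where
  "perm4 b c d = Transposition.transpose 0 b \<circ> (Transposition.transpose 1 c \<circ> Transposition.transpose 2 d)"

lemma sign_perm4: "sign (perm4 b c d) = (if b = 0 then 1 else -1) * (if c = 1 then 1 else -1) * (if d = 2 then 1 else -1)"
  unfolding perm4_def
  by (auto simp: sign_compose permutation_swap_id permutation_compose sign_swap_id)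

lemma lessThan_4: "{..<4::nat} = {0, 1, 2, 3}" by auto


lemma sum_permutations_4: "(\<Sum>p | p permutes {..<4::nat}. f p) = (\<Sum>b\<in>{0,1,2,3}. \<Sum>c\<in>{1,2,3}. \<Sum>d\<in>{2,3}. f (perm4 b c d))"
proof -
  have 3: "(\<Sum>p | p permutes {3}. g p) = g id" for g :: "(nat \<Rightarrow> nat) \<Rightarrow> 'a"
    by (subst permutes_sing) simp
  have 2: "(\<Sum>p | p permutes {2,3}. g p) = (\<Sum>d\<in>{2,3}. g (Transposition.transpose 2 d))" for g :: "(nat \<Rightarrow> nat) \<Rightarrow> 'a"
    by (subst sum_over_permutations_insert) (simp_all only: 3 o_id, auto)
  have 1: "(\<Sum>p | p permutes {1,2,3}. g p) = (\<Sum>c\<in>{1,2,3}. \<Sum>d\<in>{2,3}. g (Transposition.transpose 1 c \<circ> Transposition.transpose 2 d))" for g :: "(nat \<Rightarrow> nat) \<Rightarrow> 'a"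
    by (subst sum_over_permutations_insert) (simp_all only: 2, auto)
  show ?thesis unfolding lessThan_4 perm4_def
    by (subst sum_over_permutations_insert) (simp_all only: 1, auto)
qed

lemma permutes_insertE:
  assumes "p permutes insert a S"
  obtains b q where "b \<in> insert a S" "q permutes S" "p = Transposition.transpose a b \<circ> q"
proof -
  have "p \<in> {p. p permutes insert a S}" using assms by simp
  then show ?thesis unfolding permutes_insert using that by auto
qed

lemma permutes_4:
  assumes "p permutes {..<4}"
  shows "\<exists>b\<in>{0,1,2,3}. \<exists>c\<in>{1,2,3}. \<exists>d\<in>{2,3}. p = perm4 b c d"
proof -
  obtain b q where b: "b \<in> {0,1,2,3}" and q: "q permutes {1,2,3}" "p = Transposition.transpose 0 b \<circ> q"
    using assms unfolding lessThan_4 by (rule permutes_insertE)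
  obtain c r where c: "c \<in> {1,2,3}" and r: "r permutes {2,3}" "q = Transposition.transpose 1 c \<circ> r"
    using q(1) by (rule permutes_insertE)
  obtain d s where d: "d \<in> {2,3}" and s: "s permutes {3}" "r = Transposition.transpose 2 d \<circ> s"
    using r(1) by (rule permutes_insertE)
  have "p = perm4 b c d" unfolding perm4_def q(2) r(2) s(2) using s(1) by (simp only: permutes_sing o_id)
  with b c d show ?thesis by blast
qed

lemma card_filter: "finite A \<Longrightarrow> int (card {x\<in>A. P x}) = (\<Sum>x\<in>A. of_bool (P x))"
  by (simp add: of_bool_def sum.If_cases Int_def)



lemma perm4_values:
  "perm4 0 1 2 0 = 0" "perm4 0 1 2 1 = 1" "perm4 0 1 2 2 = 2" "perm4 0 1 2 3 = 3"
  "perm4 0 1 3 0 = 0" "perm4 0 1 3 1 = 1" "perm4 0 1 3 2 = 3" "perm4 0 1 3 3 = 2"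
  "perm4 0 2 2 0 = 0" "perm4 0 2 2 1 = 2" "perm4 0 2 2 2 = 1" "perm4 0 2 2 3 = 3"
  "perm4 0 2 3 0 = 0" "perm4 0 2 3 1 = 2" "perm4 0 2 3 2 = 3" "perm4 0 2 3 3 = 1"
  "perm4 0 3 2 0 = 0" "perm4 0 3 2 1 = 3" "perm4 0 3 2 2 = 2" "perm4 0 3 2 3 = 1"
  "perm4 0 3 3 0 = 0" "perm4 0 3 3 1 = 3" "perm4 0 3 3 2 = 1" "perm4 0 3 3 3 = 2"
  "perm4 1 1 2 0 = 1" "perm4 1 1 2 1 = 0" "perm4 1 1 2 2 = 2" "perm4 1 1 2 3 = 3"
  "perm4 1 1 3 0 = 1" "perm4 1 1 3 1 = 0" "perm4 1 1 3 2 = 3" "perm4 1 1 3 3 = 2"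
  "perm4 1 2 2 0 = 1" "perm4 1 2 2 1 = 2" "perm4 1 2 2 2 = 0" "perm4 1 2 2 3 = 3"
  "perm4 1 2 3 0 = 1" "perm4 1 2 3 1 = 2" "perm4 1 2 3 2 = 3" "perm4 1 2 3 3 = 0"
  "perm4 1 3 2 0 = 1" "perm4 1 3 2 1 = 3" "perm4 1 3 2 2 = 2" "perm4 1 3 2 3 = 0"
  "perm4 1 3 3 0 = 1" "perm4 1 3 3 1 = 3" "perm4 1 3 3 2 = 0" "perm4 1 3 3 3 = 2"
  "perm4 2 1 2 0 = 2" "perm4 2 1 2 1 = 1" "perm4 2 1 2 2 = 0" "perm4 2 1 2 3 = 3"
  "perm4 2 1 3 0 = 2" "perm4 2 1 3 1 = 1" "perm4 2 1 3 2 = 3" "perm4 2 1 3 3 = 0"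
  "perm4 2 2 2 0 = 2" "perm4 2 2 2 1 = 0" "perm4 2 2 2 2 = 1" "perm4 2 2 2 3 = 3"
  "perm4 2 2 3 0 = 2" "perm4 2 2 3 1 = 0" "perm4 2 2 3 2 = 3" "perm4 2 2 3 3 = 1"
  "perm4 2 3 2 0 = 2" "perm4 2 3 2 1 = 3" "perm4 2 3 2 2 = 0" "perm4 2 3 2 3 = 1"
  "perm4 2 3 3 0 = 2" "perm4 2 3 3 1 = 3" "perm4 2 3 3 2 = 1" "perm4 2 3 3 3 = 0"
  "perm4 3 1 2 0 = 3" "perm4 3 1 2 1 = 1" "perm4 3 1 2 2 = 2" "perm4 3 1 2 3 = 0"
  "perm4 3 1 3 0 = 3" "perm4 3 1 3 1 = 1" "perm4 3 1 3 2 = 0" "perm4 3 1 3 3 = 2"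
  "perm4 3 2 2 0 = 3" "perm4 3 2 2 1 = 2" "perm4 3 2 2 2 = 1" "perm4 3 2 2 3 = 0"
  "perm4 3 2 3 0 = 3" "perm4 3 2 3 1 = 2" "perm4 3 2 3 2 = 0" "perm4 3 2 3 3 = 1"
  "perm4 3 3 2 0 = 3" "perm4 3 3 2 1 = 0" "perm4 3 3 2 2 = 2" "perm4 3 3 2 3 = 1"
  "perm4 3 3 3 0 = 3" "perm4 3 3 3 1 = 0" "perm4 3 3 3 2 = 1" "perm4 3 3 3 3 = 2"
  by (simp_all add: perm4_def Transposition.transpose_def)

lemma character_Rho2_eq: "character Rho2 p = of_bool (p 0 = 0) + of_bool (p 1 = 1) + of_bool (p 2 = 2) + of_bool (p 3 = 3) - 1"
  unfolding character.simps lessThan_4 by (subst card_filter) auto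
lemma character_Rho1_eq: "character Rho1 p = of_bool ({{p 0, p 1}, {p 2, p 3}} = {{0, 1}, {2, 3}}) + 
   of_bool ({{p 0, p 2}, {p 1, p 3}} = {{0, 2}, {1, 3}}) + of_bool ({{p 0, p 3}, {p 1, p 2}} = {{0, 3}, {1, 2}}) - 1"
proof -
  have *: "finite splittings" by (simp add: splittings_def)
  have d: "{{0, 1}, {2, 3}} \<noteq> {{0, 2}, {1, 3::nat}}" "{{0, 1}, {2, 3}} \<noteq> {{0, 3}, {1, 2::nat}}" "{{0, 2}, {1, 3}} \<noteq> {{0, 3}, {1, 2::nat}}"
    by (simp_all add: doubleton_eq_iff)
  have "(\<Sum>x\<in>splittings. f x) = f {{0, 1}, {2, 3}} + f {{0, 2}, {1, 3}} + f {{0, 3}, {1, 2}}" for f :: "_ \<Rightarrow> int"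
    using d unfolding splittings_def by simp
  then show ?thesis 
    unfolding character.simps card_filter[OF *] by (simp only: image_insert image_empty)
qed
lemma character_perm4:
  "character Rho1 (perm4 0 1 2) = 2" "character Rho2 (perm4 0 1 2) = 3"
  "character Rho1 (perm4 0 1 3) = 0" "character Rho2 (perm4 0 1 3) = 1"
  "character Rho1 (perm4 0 2 2) = 0" "character Rho2 (perm4 0 2 2) = 1"
  "character Rho1 (perm4 0 2 3) = -1" "character Rho2 (perm4 0 2 3) = 0"
  "character Rho1 (perm4 0 3 2) = 0" "character Rho2 (perm4 0 3 2) = 1"
  "character Rho1 (perm4 0 3 3) = -1" "character Rho2 (perm4 0 3 3) = 0"
  "character Rho1 (perm4 1 1 2) = 0" "character Rho2 (perm4 1 1 2) = 1"
  "character Rho1 (perm4 1 1 3) = 2" "character Rho2 (perm4 1 1 3) = -1"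
  "character Rho1 (perm4 1 2 2) = -1" "character Rho2 (perm4 1 2 2) = 0"
  "character Rho1 (perm4 1 2 3) = 0" "character Rho2 (perm4 1 2 3) = -1"
  "character Rho1 (perm4 1 3 2) = -1" "character Rho2 (perm4 1 3 2) = 0"
  "character Rho1 (perm4 1 3 3) = 0" "character Rho2 (perm4 1 3 3) = -1"
  "character Rho1 (perm4 2 1 2) = 0" "character Rho2 (perm4 2 1 2) = 1"
  "character Rho1 (perm4 2 1 3) = -1" "character Rho2 (perm4 2 1 3) = 0"
  "character Rho1 (perm4 2 2 2) = -1" "character Rho2 (perm4 2 2 2) = 0"
  "character Rho1 (perm4 2 2 3) = 0" "character Rho2 (perm4 2 2 3) = -1"
  "character Rho1 (perm4 2 3 2) = 2" "character Rho2 (perm4 2 3 2) = -1"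
  "character Rho1 (perm4 2 3 3) = 0" "character Rho2 (perm4 2 3 3) = -1"
  "character Rho1 (perm4 3 1 2) = 0" "character Rho2 (perm4 3 1 2) = 1"
  "character Rho1 (perm4 3 1 3) = -1" "character Rho2 (perm4 3 1 3) = 0"
  "character Rho1 (perm4 3 2 2) = 2" "character Rho2 (perm4 3 2 2) = -1"
  "character Rho1 (perm4 3 2 3) = 0" "character Rho2 (perm4 3 2 3) = -1"
  "character Rho1 (perm4 3 3 2) = -1" "character Rho2 (perm4 3 3 2) = 0"
  "character Rho1 (perm4 3 3 3) = 0" "character Rho2 (perm4 3 3 3) = -1"
  by (simp_all only: character_Rho1_eq character_Rho2_eq perm4_values doubleton_eq_iff) simp_all


theorem character_tensor:
  assumes "p permutes {..<4}"
  shows "character i p * character j p = (\<Sum>k\<leftarrow>constituents i j. character k p)"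
proof -
  obtain b c d where bcd: "b \<in> {0,1,2,3}" "c \<in> {1,2,3}" "d \<in> {2,3}" and p: "p = perm4 b c d"
    using permutes_4[OF assms] by blast
  have "(character Psi p, character Rho1 p, character Rho2 p) \<in>
      {(1, 2, 3), (-1, 0, 1), (1, 2, -1), (1, -1, 0), (-1, 0, -1)}"
    unfolding p using bcd by (elim insertE emptyE; simp only: character_perm4 character.simps(2) sign_perm4; simp)
  moreover have "character Rho3 p = character Psi p * character Rho2 p" by simp
  moreover have "character Triv p = 1" by simp
  ultimately show ?thesis
    by (cases i; cases j) (auto simp del: character.simps)
qed

theorem character_orthonormal:
  "(\<Sum>p | p permutes {..<4}. character i p * character j p) = (if i = j then 24 else 0)"
proof -
  have 2: "character Psi p = sign p" "character Triv p = 1" "character Rho3 p = sign p * character Rho2 p" for p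
    by simp_all
  have "\<forall>i j. (\<Sum>b\<in>{0,1,2,3}. \<Sum>c\<in>{1,2,3}. \<Sum>d\<in>{2,3}. character i (perm4 b c d) * character j (perm4 b c d)) = (if i = j then 24 else 0)"
    unfolding all_irrep by (simp add: 2 character_perm4 sign_perm4 del: character.simps(3,4,5) One_nat_def)
  then show ?thesis unfolding sum_permutations_4 by blast
qed
section \<open>Based modules\<close>

text \<open>
  Underlying abelian groups are whole types.  The integers act through the unit map
  \<open>of_int\<close> into the ring, which is the usual \<open>\<int>\<close>-module structure of the abelian group;
  \<open>Z.independent\<close>, \<open>Z.span\<close> and \<open>Z.representation\<close> (coefficients in a basis) refer to it.
\<close>

locale rS4_module = module act
  for act :: "rS4 \<Rightarrow> 'm::ab_group_add \<Rightarrow> 'm"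
begin

sublocale Z: module "\<lambda>n. act (of_int n)"
  by unfold_locales (simp_all add: scale_right_distrib scale_left_distrib)

end

locale zplus_module = rS4_module act
  for act :: "rS4 \<Rightarrow> 'm::ab_group_add \<Rightarrow> 'm" +
  fixes B :: "'m set"
  assumes basis_independent: "Z.independent B"
    and basis_span: "Z.span B = UNIV"
    and nonneg: "\<lbrakk>b \<in> B; c \<in> B\<rbrakk> \<Longrightarrow> 0 \<le> Z.representation B (act (V i) b) c"

text \<open>
  All irreducible representations are self-dual, so that the condition
  \<open>a\<^bsub>il\<^esub>\<^bsup>k\<^esup> = a\<^bsub>i*k\<^esub>\<^bsup>l\<^esup>\<close> on the structure constants is the symmetry of each matrix.
\<close>

locale based_module = zplus_module act B
  for act :: "rS4 \<Rightarrow> 'm::ab_group_add \<Rightarrow> 'm" and B :: "'m set" +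
  assumes symmetric: "\<lbrakk>b \<in> B; c \<in> B\<rbrakk> \<Longrightarrow>
    Z.representation B (act (V i) b) c = Z.representation B (act (V i) c) b"

locale irreducible_zplus_module = zplus_module act B
  for act :: "rS4 \<Rightarrow> 'm::ab_group_add \<Rightarrow> 'm" and B :: "'m set" +
  assumes nonzero: "(UNIV :: 'm set) \<noteq> {0}"
    and no_proper_submodule: "\<lbrakk>S \<noteq> {}; S \<subset> B\<rbrakk> \<Longrightarrow> \<not> subspace (Z.span S)"

text \<open>
  An additive map is determined by its values on the basis, so \<open>\<phi>\<close> is the isomorphism induced
  by the bijection of bases to which it restricts.
\<close>

definition zplus_equivalent ::
    "(rS4 \<Rightarrow> 'm::ab_group_add \<Rightarrow> 'm) \<Rightarrow> 'm set \<Rightarrow> (rS4 \<Rightarrow> 'n::ab_group_add \<Rightarrow> 'n) \<Rightarrow> 'n set \<Rightarrow> bool" where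
  "zplus_equivalent act B act' B' \<longleftrightarrow>
     (\<exists>\<phi>. module_hom act act' \<phi> \<and> bij \<phi> \<and> \<phi> ` B = B')"

text \<open>
  The action on integer vectors in which \<open>V Psi\<close>, \<open>V Rho1\<close>, \<open>V Rho2\<close> act by the matrices
  \<open>P\<close>, \<open>A\<close>, \<open>X\<close>, and \<open>V Rho3 = V Psi * V Rho2\<close> by \<open>P ** X\<close>.
\<close>

definition matrix_scale ::
    "int^'n^'n \<Rightarrow> int^'n^'n \<Rightarrow> int^'n^'n \<Rightarrow> rS4 \<Rightarrow> int^'n \<Rightarrow> int^'n::finite" where
  "matrix_scale P A X r v =
     rS4_coeff r Triv *s v + rS4_coeff r Psi *s (P *v v) + rS4_coeff r Rho1 *s (A *v v)
     + rS4_coeff r Rho2 *s (X *v v) + rS4_coeff r Rho3 *s ((P ** X) *v v)"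

definition standard_basis :: "(int^'n::finite) set" where
  "standard_basis = range (\<lambda>i. axis i 1)"

text \<open>
  The two modules of rank five, on the standard basis of \<open>int^5\<close>; that they are irreducible
  based modules is proved in \<open>based_M51\<close> and \<open>based_M52\<close>.
\<close>

definition M51 :: "rS4 \<Rightarrow> int^5 \<Rightarrow> int^5" where
  "M51 = matrix_scale
     (vector [vector [0, 1, 0, 0, 0],
              vector [1, 0, 0, 0, 0],
              vector [0, 0, 0, 1, 0],
              vector [0, 0, 1, 0, 0],
              vector [0, 0, 0, 0, 1]])
     (vector [vector [0, 0, 0, 0, 1],
              vector [0, 0, 0, 0, 1],
              vector [0, 0, 1, 1, 0],
              vector [0, 0, 1, 1, 0],
              vector [1, 1, 0, 0, 1]])
     (vector [vector [0, 0, 0, 1, 0],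
              vector [0, 0, 1, 0, 0],
              vector [0, 1, 1, 1, 1],
              vector [1, 0, 1, 1, 1],
              vector [0, 0, 1, 1, 0]])"

definition M52 :: "rS4 \<Rightarrow> int^5 \<Rightarrow> int^5" where
  "M52 = matrix_scale
     (vector [vector [0, 1, 0, 0, 0],
              vector [1, 0, 0, 0, 0],
              vector [0, 0, 0, 1, 0],
              vector [0, 0, 1, 0, 0],
              vector [0, 0, 0, 0, 1]])
     (vector [vector [1, 1, 0, 0, 0],
              vector [1, 1, 0, 0, 0],
              vector [0, 0, 1, 1, 0],
              vector [0, 0, 1, 1, 0],
              vector [0, 0, 0, 0, 2]])
     (vector [vector [0, 0, 0, 1, 1],
              vector [0, 0, 1, 0, 1],
              vector [0, 1, 0, 0, 1],
              vector [1, 0, 0, 0, 1],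
              vector [1, 1, 1, 1, 1]])"

lemma exhaust_5: "x = 1 \<or> x = 2 \<or> x = 3 \<or> x = 4 \<or> x = 5" for x :: 5
proof (induct x)
  case (of_int z)
  then have "0 \<le> z" and "z < 5" by simp_all
  then have "z = 0 \<or> z = 1 \<or> z = 2 \<or> z = 3 \<or> z = 4" by arith
  then show ?case by auto
qed
lemma all_5: "(\<forall>i::5. P i) \<longleftrightarrow> P 1 \<and> P 2 \<and> P 3 \<and> P 4 \<and> P 5"
  by (metis exhaust_5)
lemma UNIV_5: "UNIV = {1, 2, 3, 4, 5 :: 5}"
  using exhaust_5 by auto
lemma sum_5: "(\<Sum>i\<in>UNIV. f (i::5)) = f 1 + f 2 + f 3 + f 4 + (f 5 :: 'a::comm_monoid_add)"
  unfolding UNIV_5 by (simp add: ac_simps)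
lemma vector_5:
  "(vector [a, b, c, d, e] :: 'a::zero^5) $ 1 = a"
  "(vector [a, b, c, d, e] :: 'a::zero^5) $ 2 = b"
  "(vector [a, b, c, d, e] :: 'a::zero^5) $ 3 = c"
  "(vector [a, b, c, d, e] :: 'a::zero^5) $ 4 = d"
  "(vector [a, b, c, d, e] :: 'a::zero^5) $ 5 = e"
  unfolding vector_def by simp_all

lemma M51_component:
  "M51 r v = vector [
    rS4_coeff r Triv * v $ 1 + rS4_coeff r Psi * v $ 2 + rS4_coeff r Rho1 * v $ 5 + rS4_coeff r Rho2 * v $ 4 + rS4_coeff r Rho3 * v $ 3,
    rS4_coeff r Triv * v $ 2 + rS4_coeff r Psi * v $ 1 + rS4_coeff r Rho1 * v $ 5 + rS4_coeff r Rho2 * v $ 3 + rS4_coeff r Rho3 * v $ 4,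
    rS4_coeff r Triv * v $ 3 + rS4_coeff r Psi * v $ 4 + rS4_coeff r Rho1 * (v $ 3 + v $ 4) + rS4_coeff r Rho2 * (v $ 2 + v $ 3 + v $ 4 + v $ 5) + rS4_coeff r Rho3 * (v $ 1 + v $ 3 + v $ 4 + v $ 5),
    rS4_coeff r Triv * v $ 4 + rS4_coeff r Psi * v $ 3 + rS4_coeff r Rho1 * (v $ 3 + v $ 4) + rS4_coeff r Rho2 * (v $ 1 + v $ 3 + v $ 4 + v $ 5) + rS4_coeff r Rho3 * (v $ 2 + v $ 3 + v $ 4 + v $ 5),
    rS4_coeff r Triv * v $ 5 + rS4_coeff r Psi * v $ 5 + rS4_coeff r Rho1 * (v $ 1 + v $ 2 + v $ 5) + rS4_coeff r Rho2 * (v $ 3 + v $ 4) + rS4_coeff r Rho3 * (v $ 3 + v $ 4)]"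
  by (simp add: vec_eq_iff all_5 M51_def matrix_scale_def vector_5 sum_5 matrix_vector_mult_def matrix_matrix_mult_def)

lemma M52_component:
  "M52 r v = vector [
    rS4_coeff r Triv * v $ 1 + rS4_coeff r Psi * v $ 2 + rS4_coeff r Rho1 * (v $ 1 + v $ 2) + rS4_coeff r Rho2 * (v $ 4 + v $ 5) + rS4_coeff r Rho3 * (v $ 3 + v $ 5),
    rS4_coeff r Triv * v $ 2 + rS4_coeff r Psi * v $ 1 + rS4_coeff r Rho1 * (v $ 1 + v $ 2) + rS4_coeff r Rho2 * (v $ 3 + v $ 5) + rS4_coeff r Rho3 * (v $ 4 + v $ 5),
    rS4_coeff r Triv * v $ 3 + rS4_coeff r Psi * v $ 4 + rS4_coeff r Rho1 * (v $ 3 + v $ 4) + rS4_coeff r Rho2 * (v $ 2 + v $ 5) + rS4_coeff r Rho3 * (v $ 1 + v $ 5),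
    rS4_coeff r Triv * v $ 4 + rS4_coeff r Psi * v $ 3 + rS4_coeff r Rho1 * (v $ 3 + v $ 4) + rS4_coeff r Rho2 * (v $ 1 + v $ 5) + rS4_coeff r Rho3 * (v $ 2 + v $ 5),
    rS4_coeff r Triv * v $ 5 + rS4_coeff r Psi * v $ 5 + rS4_coeff r Rho1 * (2 * v $ 5) + (rS4_coeff r Rho2 + rS4_coeff r Rho3) * (v $ 1 + v $ 2 + v $ 3 + v $ 4 + v $ 5)]"
  by (simp add: vec_eq_iff all_5 M52_def matrix_scale_def vector_5 sum_5 matrix_vector_mult_def matrix_matrix_mult_def algebra_simps)

lemma module_int_vec:
  fixes act :: "rS4 \<Rightarrow> int^'n::finite \<Rightarrow> int^'n"
  assumes add: "\<And>r v w. act r (v + w) = act r v + act r w"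
    and cmult: "\<And>r c v. act r (c *s v) = c *s act r v"
    and expand: "\<And>r v. act r v = (\<Sum>i\<in>UNIV. rS4_coeff r i *s act (V i) v)"
    and one: "\<And>v. act (V Triv) v = v"
    and tensor: "\<And>i j v. act (V i) (act (V j) v) =
      (\<Sum>k\<in>UNIV. int (count_list (constituents i j) k) *s act (V k) v)"
  shows "module act"
proof
  fix a b v w
  show "act a (v + w) = act a v + act a w" by (rule add)
  show "act (a + b) v = act a v + act b v"
    by (subst (1 2 3) expand) (simp add: vector_sadd_rdistrib sum.distrib)
  show "act 1 v = v"
    by (simp add: one flip: V_Triv)
  have zero: "act r 0 = 0" for r
    using add[of r 0 0] by simp
  have sum: "act r (\<Sum>i\<in>I. f i) = (\<Sum>i\<in>I. act r (f i))" for r and f :: "irrep \<Rightarrow> int^'n" and I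
    by (induction I rule: infinite_finite_induct) (simp_all add: zero add)
  have sm: "(\<Sum>i\<in>I. f i *s u) = (\<Sum>i\<in>I. f i) *s u" for f :: "irrep \<Rightarrow> int" and u :: "int^'n" and I
    by (simp add: vec_eq_iff sum_distrib_right)
  have sm2: "(c *s (\<Sum>i\<in>I. f i)) = (\<Sum>i\<in>I. c *s f i)" for f :: "irrep \<Rightarrow> int^'n" and c and I
    by (simp add: vec_eq_iff sum_distrib_left)
  have "act a (act b v) = (\<Sum>i\<in>UNIV. \<Sum>j\<in>UNIV. \<Sum>k\<in>UNIV.
      (rS4_coeff a i * rS4_coeff b j * int (count_list (constituents i j) k)) *s act (V k) v)"
    by (subst expand, subst (2) expand)
      (simp add: sum cmult tensor sm2 vector_smult_assoc mult_ac)
  also have "\<dots> = (\<Sum>k\<in>UNIV. \<Sum>i\<in>UNIV. \<Sum>j\<in>UNIV.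
      (rS4_coeff a i * rS4_coeff b j * int (count_list (constituents i j) k)) *s act (V k) v)"
    by (rule trans[OF sum.cong[OF refl sum.swap]], rule sum.swap)
  also have "\<dots> = act (a * b) v"
    by (subst (2) expand) (simp add: sm rS4_coeff_mult)
  finally show "act a (act b v) = act (a * b) v" .
qed

lemma module_M51: "module M51"
proof (rule module_int_vec)
  show "M51 (V i) (M51 (V j) v) =
      (\<Sum>k\<in>UNIV. int (count_list (constituents i j) k) *s M51 (V k) v)" for i j v
    by (cases i; cases j; simp add: vec_eq_iff all_5 M51_component vector_5 sum_irrep)
qed (simp_all add: vec_eq_iff all_5 M51_component vector_5 sum_irrep algebra_simps)

lemma module_M52: "module M52"
proof (rule module_int_vec)
  show "M52 (V i) (M52 (V j) v) =
      (\<Sum>k\<in>UNIV. int (count_list (constituents i j) k) *s M52 (V k) v)" for i j v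
    by (cases i; cases j; simp add: vec_eq_iff all_5 M52_component vector_5 sum_irrep)
qed (simp_all add: vec_eq_iff all_5 M52_component vector_5 sum_irrep algebra_simps)

lemma module_int_vector: "module ((*s) :: int \<Rightarrow> int^'n::finite \<Rightarrow> int^'n)"
  by unfold_locales (simp_all add: vec_eq_iff algebra_simps)

interpretation int_vec: module "(*s) :: int \<Rightarrow> int^'n::finite \<Rightarrow> int^'n"
  by (rule module_int_vector)

lemma card_standard_basis: "card (standard_basis :: (int^'n::finite) set) = CARD('n)"
  unfolding standard_basis_def by (rule card_image) (auto simp: inj_def axis_eq_axis)

lemma finite_standard_basis: "finite (standard_basis :: (int^'n::finite) set)"
  unfolding standard_basis_def by simp

lemma sum_standard_basis: "(\<Sum>b\<in>standard_basis. f b) = (\<Sum>i\<in>UNIV. f (axis i 1 :: int^'n::finite))"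
  unfolding standard_basis_def by (subst sum.reindex) (auto simp: inj_def axis_eq_axis)

lemma independent_standard_basis: "int_vec.independent (standard_basis :: (int^'n::finite) set)"
  unfolding int_vec.dependent_finite[OF finite_standard_basis]
proof (clarify)
  fix u and b :: "int^'n" assume "b \<in> standard_basis" "u b \<noteq> 0"
    and 0: "(\<Sum>v\<in>standard_basis. u v *s v) = (0 :: int^'n)"
  then obtain i where "b = axis i 1" unfolding standard_basis_def by blast
  moreover have "u (axis i 1) = (\<Sum>v\<in>standard_basis. u v *s v) $ i"
    by (simp add: sum_standard_basis axis_def if_distrib cong: if_cong)
  ultimately show False using 0 \<open>u b \<noteq> 0\<close> by simp
qed

lemma span_standard_basis: "int_vec.span (standard_basis :: (int^'n::finite) set) = UNIV"
proof -
  have "v \<in> int_vec.span standard_basis" for v :: "int^'n"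
  proof -
    have "(\<Sum>i\<in>UNIV. v $ i *s axis i 1) \<in> int_vec.span standard_basis"
      by (intro int_vec.span_sum int_vec.span_scale int_vec.span_base) (simp add: standard_basis_def)
    then show ?thesis by (simp only: basis_expansion)
  qed
  then show ?thesis by blast
qed

lemma representation_standard_basis:
  "int_vec.representation standard_basis v (axis i 1) = (v :: int^'n::finite) $ i"
proof -
  let ?r = "int_vec.representation standard_basis v"
  have "(\<Sum>b\<in>standard_basis. ?r b *s b) = v"
    by (rule int_vec.sum_representation_eq)
      (simp_all add: independent_standard_basis span_standard_basis finite_standard_basis)
  then have "v $ i = (\<Sum>b\<in>standard_basis. ?r b *s b) $ i" by simp
  also have "\<dots> = ?r (axis i 1)"
    by (simp add: sum_standard_basis axis_def if_distrib cong: if_cong)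
  finally show ?thesis by simp
qed

lemma based_module_standard_basis:
  fixes act :: "rS4 \<Rightarrow> int^'n::finite \<Rightarrow> int^'n"
  assumes "module act"
    and of_int: "\<And>n v. act (of_int n) v = n *s v"
    and nonneg: "\<And>i j k. 0 \<le> act (V i) (axis j 1) $ k"
    and symmetric: "\<And>i j k. act (V i) (axis j 1) $ k = act (V i) (axis k 1) $ j"
    and connected: "\<And>J. J \<noteq> {} \<Longrightarrow> (\<And>i j k. j \<in> J \<Longrightarrow> act (V i) (axis j 1) $ k \<noteq> 0 \<Longrightarrow> k \<in> J) \<Longrightarrow> J = UNIV"
  shows "based_module act standard_basis" "irreducible_zplus_module act standard_basis"
proof -
  interpret A: rS4_module act
    using assms(1) by (simp add: rS4_module_def)
  have Z: "(\<lambda>n. act (of_int n)) = (*s)"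
    by (simp add: fun_eq_iff of_int)
  interpret A: zplus_module act standard_basis
  proof
    show "A.Z.independent standard_basis" unfolding Z by (rule independent_standard_basis)
    show "A.Z.span standard_basis = UNIV" unfolding Z by (rule span_standard_basis)
    fix b c :: "int^'n" and i
    assume "b \<in> standard_basis" "c \<in> standard_basis"
    then obtain j k where [simp]: "b = axis j 1" "c = axis k 1"
      unfolding standard_basis_def by blast
    show "0 \<le> A.Z.representation standard_basis (act (V i) b) c"
      unfolding Z by (simp add: representation_standard_basis nonneg)
  qed
  show "based_module act standard_basis"
  proof
    fix b c :: "int^'n" and i
    assume "b \<in> standard_basis" "c \<in> standard_basis"
    then obtain j k where [simp]: "b = axis j 1" "c = axis k 1"
      unfolding standard_basis_def by blast
    show "A.Z.representation standard_basis (act (V i) b) c = A.Z.representation standard_basis (act (V i) c) b"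
      unfolding Z by (simp add: representation_standard_basis symmetric[of i j k])
  qed
  show "irreducible_zplus_module act standard_basis"
  proof
    have "axis undefined 1 \<noteq> (0 :: int^'n)" by simp
    then show "(UNIV :: (int^'n) set) \<noteq> {0}" by blast
  next
    fix S :: "(int^'n) set" assume S: "S \<noteq> {}" "S \<subset> standard_basis"
    define J where "J = {j. axis j 1 \<in> S}"
    show "\<not> A.subspace (A.Z.span S)"
    proof
      assume sub: "A.subspace (A.Z.span S)"
      have supp: "v $ k = 0" if "v \<in> int_vec.span S" "k \<notin> J" for v k
        using that
      proof (induction rule: int_vec.span_induct_alt)
        case (step c x y)
        then obtain j where "x = axis j 1" "j \<noteq> k"
          using S(2) unfolding standard_basis_def J_def by blast
        with step show ?case by (simp add: axis_def)
      qed simp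
      obtain b where "b \<in> S" using S(1) by blast
      moreover from this obtain j where "b = axis j 1"
        using S(2) unfolding standard_basis_def by blast
      ultimately have "J \<noteq> {}" by (auto simp: J_def)
      then have "J = UNIV"
      proof (rule connected)
        fix i j k assume j: "j \<in> J" and nz: "act (V i) (axis j 1) $ k \<noteq> 0"
        have "act (V i) (axis j 1) \<in> A.Z.span S"
          using j by (intro A.subspace_scale[OF sub] A.Z.span_base) (simp add: J_def)
        with nz supp show "k \<in> J" unfolding Z by blast
      qed
      then have "standard_basis \<subseteq> S" unfolding standard_basis_def J_def by blast
      with S(2) show False by blast
    qed
  qed
qed

lemma based_M51: "based_module M51 standard_basis" "irreducible_zplus_module M51 standard_basis"
proof -
  have n: "\<forall>i j k. 0 \<le> M51 (V i) (axis j 1) $ k"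
    by (simp add: all_irrep all_5 M51_component vector_5 axis_def)
  have s: "\<forall>i j k. M51 (V i) (axis j 1) $ k = M51 (V i) (axis k 1) $ j"
    by (simp add: all_irrep all_5 M51_component vector_5 axis_def)
  have c: "J = UNIV" if "J \<noteq> {}"
    and *: "\<And>i j k. j \<in> J \<Longrightarrow> M51 (V i) (axis j 1) $ k \<noteq> 0 \<Longrightarrow> k \<in> J" for J
  proof -
    have e: "j \<in> J \<longrightarrow> k \<in> J" if "M51 (V Rho2) (axis j 1) $ k \<noteq> 0" for j k
      using * that by blast
    have "1 \<in> J \<longrightarrow> 4 \<in> J" "4 \<in> J \<longrightarrow> 3 \<in> J" "2 \<in> J \<longrightarrow> 3 \<in> J" "3 \<in> J \<longrightarrow> 2 \<in> J" "3 \<in> J \<longrightarrow> 4 \<in> J" "3 \<in> J \<longrightarrow> 5 \<in> J" "5 \<in> J \<longrightarrow> 3 \<in> J" "4 \<in> J \<longrightarrow> 1 \<in> J"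
      by (rule e; simp add: M51_component vector_5 axis_def)+
    moreover obtain x where "x \<in> J" using \<open>J \<noteq> {}\<close> by blast
    with exhaust_5[of x] have "1 \<in> J \<or> 2 \<in> J \<or> 3 \<in> J \<or> 4 \<in> J \<or> 5 \<in> J" by (elim disjE) simp_all
    ultimately have "1 \<in> J \<and> 2 \<in> J \<and> 3 \<in> J \<and> 4 \<in> J \<and> 5 \<in> J" by argo
    then show ?thesis unfolding all_5[symmetric, of "\<lambda>x. x \<in> J"] by blast
  qed
  have o: "M51 (of_int n) v = n *s v" for n v
    by (simp add: vec_eq_iff all_5 M51_component vector_5)
  show "based_module M51 standard_basis" "irreducible_zplus_module M51 standard_basis"
    by (rule based_module_standard_basis[OF module_M51 o n[rule_format] s[rule_format] c]; assumption)+
qed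

lemma based_M52: "based_module M52 standard_basis" "irreducible_zplus_module M52 standard_basis"
proof -
  have n: "\<forall>i j k. 0 \<le> M52 (V i) (axis j 1) $ k"
    by (simp add: all_irrep all_5 M52_component vector_5 axis_def)
  have s: "\<forall>i j k. M52 (V i) (axis j 1) $ k = M52 (V i) (axis k 1) $ j"
    by (simp add: all_irrep all_5 M52_component vector_5 axis_def)
  have c: "J = UNIV" if "J \<noteq> {}"
    and *: "\<And>i j k. j \<in> J \<Longrightarrow> M52 (V i) (axis j 1) $ k \<noteq> 0 \<Longrightarrow> k \<in> J" for J
  proof -
    have e: "j \<in> J \<longrightarrow> k \<in> J" if "M52 (V Rho2) (axis j 1) $ k \<noteq> 0" for j k
      using * that by blast
    have "1 \<in> J \<longrightarrow> 5 \<in> J" "2 \<in> J \<longrightarrow> 5 \<in> J" "3 \<in> J \<longrightarrow> 5 \<in> J" "4 \<in> J \<longrightarrow> 5 \<in> J" "5 \<in> J \<longrightarrow> 1 \<in> J" "5 \<in> J \<longrightarrow> 2 \<in> J" "5 \<in> J \<longrightarrow> 3 \<in> J" "5 \<in> J \<longrightarrow> 4 \<in> J"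
      by (rule e; simp add: M52_component vector_5 axis_def)+
    moreover obtain x where "x \<in> J" using \<open>J \<noteq> {}\<close> by blast
    with exhaust_5[of x] have "1 \<in> J \<or> 2 \<in> J \<or> 3 \<in> J \<or> 4 \<in> J \<or> 5 \<in> J" by (elim disjE) simp_all
    ultimately have "1 \<in> J \<and> 2 \<in> J \<and> 3 \<in> J \<and> 4 \<in> J \<and> 5 \<in> J" by argo
    then show ?thesis unfolding all_5[symmetric, of "\<lambda>x. x \<in> J"] by blast
  qed
  have o: "M52 (of_int n) v = n *s v" for n v
    by (simp add: vec_eq_iff all_5 M52_component vector_5)
  show "based_module M52 standard_basis" "irreducible_zplus_module M52 standard_basis"
    by (rule based_module_standard_basis[OF module_M52 o n[rule_format] s[rule_format] c]; assumption)+
qed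

end

(*
  Vpsi acts by an involution p of the basis, and the row equations of Vrho1^2 = 1 + Vpsi + Vrho1
  leave few possibilities for the matrix a of Vrho1.  By irreducibility, any two basis elements
  are linked by some V_i: the span of all elements linked to a given one is a submodule.  Hence
  the matrix x of Vrho2 is nonzero wherever the other matrices do not provide a link, while the
  diagonal entries of Vrho2^2 = 1 + Vrho1 + Vrho2 + Vrho3 bound the squared norms of its rows.
  The two requirements are incompatible when p has three or five fixed points.  When p has
  one fixed point, a determines x up to interchanging the two elements of a 2-cycle of p.
*)

theory Submission
  imports Defs
begin

section \<open>Structure constants of a module with nonnegative matrices\<close>

context zplus_module
begin

definition coeff :: "rS4 \<Rightarrow> 'm \<Rightarrow> 'm \<Rightarrow> int" where
  "coeff r b c = Z.representation B (act r b) c"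

lemma in_span [simp]: "u \<in> Z.span B"
  by (simp add: basis_span)

lemma coeff_add: "coeff (r + s) b c = coeff r b c + coeff s b c"
  by (simp add: coeff_def scale_left_distrib Z.representation_add[OF basis_independent])

lemma coeff_0: "coeff 0 b c = 0"
  by (simp add: coeff_def Z.representation_zero)

lemma coeff_1: "b \<in> B \<Longrightarrow> coeff 1 b c = of_bool (b = c)"
  by (simp add: coeff_def Z.representation_basis[OF basis_independent])

lemma coeff_sum_list: "coeff (\<Sum>k\<leftarrow>ks. V k) b c = (\<Sum>k\<leftarrow>ks. coeff (V k) b c)"
  by (induction ks) (simp_all add: coeff_0 coeff_add)

lemma coeff_nonneg: "b \<in> B \<Longrightarrow> c \<in> B \<Longrightarrow> 0 \<le> coeff (V i) b c"
  by (simp add: coeff_def nonneg)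

lemma sum_coeff: "finite B \<Longrightarrow> (\<Sum>c\<in>B. act (of_int (coeff r b c)) c) = act r b"
  unfolding coeff_def by (rule Z.sum_representation_eq[OF basis_independent]) simp_all

text \<open>Expanding \<open>act s b\<close> in the basis comes first, and the first index belongs
  to the argument, so the matrices are multiplied in reversed order.\<close>

lemma coeff_mult:
  assumes "finite B"
  shows "coeff (r * s) b c = (\<Sum>d\<in>B. coeff s b d * coeff r d c)"
proof -
  have "act (r * s) b = act r (\<Sum>d\<in>B. act (of_int (coeff s b d)) d)"
    by (simp add: sum_coeff[OF assms])
  also have "\<dots> = (\<Sum>d\<in>B. act (of_int (coeff s b d)) (act r d))"
    by (simp add: scale_sum_right mult.commute)
  finally have "coeff (r * s) b c = Z.representation B (\<Sum>d\<in>B. act (of_int (coeff s b d)) (act r d)) c"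
    by (simp add: coeff_def)
  also have "\<dots> = (\<Sum>d\<in>B. coeff s b d * coeff r d c)"
    by (subst Z.representation_sum[OF basis_independent])
      (simp_all add: Z.representation_scale[OF basis_independent] coeff_def del: scale_scale)
  finally show ?thesis .
qed

lemma act_expand: "act r u = (\<Sum>i\<in>UNIV. act (of_int (rS4_coeff r i)) (act (V i) u))"
  by (subst rS4_expand) (simp add: scale_sum_left)

end

section \<open>Extending bijections of bases to module isomorphisms\<close>

text \<open>The extension is linear over the integers, written with the coordinates in
  \<open>B\<close>. Agreement of the matrices gives compatibility with each \<open>V i\<close> on
  basis elements; expanding the ring element in the \<open>V i\<close> and the vector in
  \<open>B\<close> gives the rest.\<close>

lemma zplus_module_hom_extend:
  assumes "zplus_module act B" "zplus_module act' B'" "finite B" "bij_betw e B B'"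
    and coeff: "\<And>i b c. b \<in> B \<Longrightarrow> c \<in> B \<Longrightarrow>
      zplus_module.coeff act' B' (V i) (e b) (e c) = zplus_module.coeff act B (V i) b c"
  shows "\<exists>\<phi>. module_hom act act' \<phi> \<and> (\<forall>b\<in>B. \<phi> b = e b)"
proof -
  interpret M: zplus_module act B by fact
  interpret N: zplus_module act' B' by fact
  have fin: "finite B'"
    using assms(3,4) bij_betw_finite by blast
  define \<phi> where "\<phi> u = (\<Sum>b\<in>B. act' (of_int (M.Z.representation B u b)) (e b))" for u
  have add: "\<phi> (u + v) = \<phi> u + \<phi> v" for u v
    by (simp add: \<phi>_def M.Z.representation_add[OF M.basis_independent]
        N.scale_left_distrib sum.distrib)
  have scale: "\<phi> (act (of_int n) u) = act' (of_int n) (\<phi> u)" for n u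
    by (simp add: \<phi>_def M.Z.representation_scale[OF M.basis_independent] N.scale_sum_right)
  have "\<phi> 0 = 0"
    by (simp add: \<phi>_def M.Z.representation_zero)
  then have sum: "\<phi> (\<Sum>i\<in>I. f i) = (\<Sum>i\<in>I. \<phi> (f i))" for f and I :: "irrep set"
    by (induction I rule: infinite_finite_induct) (simp_all add: add)
  have base: "\<phi> b = e b" if "b \<in> B" for b
  proof -
    have "\<phi> b = (\<Sum>c\<in>B. if c = b then e c else 0)"
      unfolding \<phi>_def using that
      by (intro sum.cong) (auto simp: M.Z.representation_basis[OF M.basis_independent])
    then show ?thesis
      using that assms(3) by simp
  qed
  have V: "\<phi> (act (V i) b) = act' (V i) (e b)" if "b \<in> B" for i b
  proof -
    have "\<phi> (act (V i) b) = (\<Sum>c\<in>B. act' (of_int (N.coeff (V i) (e b) (e c))) (e c))"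
      using that by (simp add: \<phi>_def coeff M.coeff_def)
    also have "\<dots> = (\<Sum>c\<in>B'. act' (of_int (N.coeff (V i) (e b) c)) c)"
      by (rule sum.reindex_bij_betw[OF assms(4)])
    finally show ?thesis
      by (simp add: N.sum_coeff[OF fin])
  qed
  have hom: "\<phi> (act r u) = act' r (\<phi> u)" for r u
  proof -
    have "u \<in> M.Z.span B" by simp
    then show ?thesis
    proof (induction rule: M.Z.span_induct_alt)
      case base
      show ?case using \<open>\<phi> 0 = 0\<close> by simp
    next
      case (step n b v)
      have "\<phi> (act r b) = act' r (\<phi> b)"
        using step(1) by (subst M.act_expand, subst N.act_expand)
          (simp add: sum scale V base del: M.scale_scale N.scale_scale)
      \<comment> \<open>Integer scalars can be moved past \<open>r\<close> because the ring is
        commutative.\<close>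
      then have "\<phi> (act r (act (of_int n) b)) = act' r (\<phi> (act (of_int n) b))"
        by (simp only: M.scale_left_commute[of r] N.scale_left_commute[of r] scale)
      with step show ?case
        by (simp only: M.scale_right_distrib N.scale_right_distrib add)
    qed
  qed
  have "module_hom act act' \<phi>"
    by unfold_locales (simp_all add: add hom)
  with base show ?thesis by blast
qed

text \<open>Serves to recognise two extensions as mutually inverse: an endomorphism is determined by
  its values on a spanning set.\<close>

lemma (in zplus_module) endomorphism_eq_id:
  assumes "module_hom act act \<phi>" "\<And>b. b \<in> B \<Longrightarrow> \<phi> b = b"
  shows "\<phi> u = u"
proof -
  interpret module_hom act act \<phi> by fact
  have "u \<in> Z.span B" by simp
  then show ?thesis
    by (induction rule: Z.span_induct_alt) (simp_all add: add scale assms(2))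
qed

text \<open>The inverse bijection matches the matrices as well, so both directions extend, and the
  two composites fix the bases pointwise.\<close>

lemma zplus_equivalentI:
  assumes "zplus_module act B" "zplus_module act' B'" "finite B" "bij_betw e B B'"
    and coeff: "\<And>i b c. b \<in> B \<Longrightarrow> c \<in> B \<Longrightarrow>
      zplus_module.coeff act' B' (V i) (e b) (e c) = zplus_module.coeff act B (V i) b c"
  shows "zplus_equivalent act B act' B'"
proof -
  let ?f = "inv_into B e"
  obtain \<phi> where \<phi>: "module_hom act act' \<phi>" "\<And>b. b \<in> B \<Longrightarrow> \<phi> b = e b"
    using zplus_module_hom_extend[OF assms] by blast
  have f: "bij_betw ?f B' B"
    by (rule bij_betw_inv_into) fact
  have e_f: "e (?f b) = b" if "b \<in> B'" for b
    using that assms(4) by (simp add: bij_betw_inv_into_right)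
  have "zplus_module.coeff act B (V i) (?f b) (?f c) = zplus_module.coeff act' B' (V i) b c"
    if "b \<in> B'" "c \<in> B'" for i b c
    using coeff[of "?f b" "?f c" i] that bij_betwE[OF f] by (simp add: e_f)
  then obtain \<psi> where \<psi>: "module_hom act' act \<psi>" "\<And>b. b \<in> B' \<Longrightarrow> \<psi> b = ?f b"
    using zplus_module_hom_extend[OF assms(2,1) _ f] assms(3) bij_betw_finite[OF f] by blast
  have "(\<psi> \<circ> \<phi>) u = u" for u
  proof (rule zplus_module.endomorphism_eq_id[OF assms(1)])
    show "module_hom act act (\<psi> \<circ> \<phi>)"
      by (rule module_hom_compose[OF \<phi>(1) \<psi>(1)])
    show "(\<psi> \<circ> \<phi>) b = b" if "b \<in> B" for b
      using that assms(4) bij_betwE[OF assms(4)] by (simp add: \<phi> \<psi> bij_betw_inv_into_left)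
  qed
  moreover have "(\<phi> \<circ> \<psi>) u = u" for u
  proof (rule zplus_module.endomorphism_eq_id[OF assms(2)])
    show "module_hom act' act' (\<phi> \<circ> \<psi>)"
      by (rule module_hom_compose[OF \<psi>(1) \<phi>(1)])
    show "(\<phi> \<circ> \<psi>) b = b" if "b \<in> B'" for b
      using that bij_betwE[OF f] by (simp add: \<phi> \<psi> e_f)
  qed
  ultimately have "bij \<phi>"
    by (intro o_bij[of \<psi>]) auto
  moreover have "\<phi> ` B = B'"
    using \<phi>(2) assms(4) by (simp add: bij_betw_def)
  ultimately show ?thesis
    unfolding zplus_equivalent_def using \<phi>(1) by blast
qed

section \<open>Links between basis elements of an irreducible module\<close>

text \<open>One step from \<open>b\<close> suffices: a step by \<open>V i\<close> after one by
  \<open>V j\<close> is covered by the constituents of \<open>V i * V j\<close>, since nonnegativity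
  rules out cancellation.\<close>

lemma (in irreducible_zplus_module) coeff_connected:
  assumes fin: "finite B" and b: "b \<in> B" and c: "c \<in> B"
  shows "\<exists>i. coeff (V i) b c \<noteq> 0"
proof -
  define S where "S = {c \<in> B. \<exists>i. coeff (V i) b c \<noteq> 0}"
  have "coeff (V Triv) b b \<noteq> 0"
    using b by (simp add: V_Triv coeff_1)
  with b have "S \<noteq> {}" by (auto simp: S_def)
  have V: "act (V i) d \<in> Z.span S" if d: "d \<in> S" for i d
  proof -
    have "act (of_int (coeff (V i) d e)) e \<in> Z.span S" if e: "e \<in> B" for e
    proof (cases "coeff (V i) d e = 0")
      case False
      obtain j where j: "coeff (V j) b d \<noteq> 0" and dB: "d \<in> B"
        using d by (auto simp: S_def)
      \<comment> \<open>The path through \<open>d\<close> contributes a positive term to the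
        \<open>(b, e)\<close> entry of \<open>V i * V j\<close>, and all other terms are
        nonnegative.\<close>
      have "coeff (V j) b d * coeff (V i) d e \<le> (\<Sum>d\<in>B. coeff (V j) b d * coeff (V i) d e)"
        using b e by (intro member_le_sum[OF dB _ fin] mult_nonneg_nonneg coeff_nonneg) auto
      moreover have "0 < coeff (V j) b d * coeff (V i) d e"
        using False j coeff_nonneg[OF b dB, of j] coeff_nonneg[OF dB e, of i]
        by (simp add: less_le)
      moreover have "(\<Sum>d\<in>B. coeff (V j) b d * coeff (V i) d e)
          = (\<Sum>k\<leftarrow>constituents i j. coeff (V k) b e)"
        by (simp only: coeff_mult[OF fin, symmetric] V_mult coeff_sum_list)
      ultimately have "(\<Sum>k\<leftarrow>constituents i j. coeff (V k) b e) \<noteq> 0"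
        by simp
      then have "\<exists>k. coeff (V k) b e \<noteq> 0"
        by (rule contrapos_np) simp
      with e have "e \<in> S" by (simp add: S_def)
      then show ?thesis by (intro Z.span_scale Z.span_base)
    qed (simp add: Z.span_zero)
    then have "(\<Sum>e\<in>B. act (of_int (coeff (V i) d e)) e) \<in> Z.span S"
      by (rule Z.span_sum)
    then show ?thesis by (simp add: sum_coeff[OF fin])
  qed
  have "act r u \<in> Z.span S" if "u \<in> Z.span S" for r u
    using that
  proof (induction rule: Z.span_induct_alt)
    case base
    show ?case by (simp add: Z.span_zero)
  next
    case (step n d v)
    have "act r d \<in> Z.span S"
      by (subst act_expand) (intro Z.span_sum Z.span_scale V step)
    then have "act (of_int n) (act r d) \<in> Z.span S"
      by (rule Z.span_scale)
    with step show ?case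
      by (simp add: scale_right_distrib mult.commute Z.span_add)
  qed
  then have "subspace (Z.span S)"
    by (intro subspaceI) (simp_all add: Z.span_zero Z.span_add)
  with \<open>S \<noteq> {}\<close> have "\<not> S \<subset> B"
    using no_proper_submodule by blast
  then have "S = B" by (auto simp: S_def)
  with c show ?thesis by (auto simp: S_def)
qed

section \<open>Involutions of three and of five points\<close>

lemma involution_on_3:
  assumes "card S = 3" "\<And>b. b \<in> S \<Longrightarrow> p b \<in> S" "\<And>b. b \<in> S \<Longrightarrow> p (p b) = b"
  obtains b c d where "S = {b, c, d}" "distinct [b, c, d]" "p b = b" "p c = c" "p d = d"
    | b c d where "S = {b, c, d}" "distinct [b, c, d]" "p b = c" "p c = b" "p d = d"
proof -
  obtain b c d where S: "S = {b, c, d}" "b \<noteq> c" "b \<noteq> d" "c \<noteq> d"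
    using assms(1) by (auto simp: card_3_iff)
  have p: "p b \<in> {b, c, d}" "p c \<in> {b, c, d}" "p d \<in> {b, c, d}" "p (p b) = b" "p (p c) = c" "p (p d) = d"
    using assms(2,3) unfolding S by blast+
  consider "p b = b" "p c = c" "p d = d" | "p b = c" "p c = b" "p d = d"
    | "p b = d" "p d = b" "p c = c" | "p c = d" "p d = c" "p b = b"
    using p S by (elim insertE emptyE) auto
  then show ?thesis
  proof cases
    case 1 then show ?thesis using that(1)[of b c d] S by auto
  next
    case 2 then show ?thesis using that(2)[of b c d] S by auto
  next
    case 3 then show ?thesis using that(2)[of b d c] S by auto
  next
    case 4 then show ?thesis using that(2)[of c d b] S by auto
  qed
qed

text \<open>If some \<open>b\<close> is moved, its 2-cycle splits off and \<open>p\<close> restricts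
  to an involution of the other three points. The case names count the fixed points.\<close>

lemma involution_on_5:
  fixes p :: "'b::finite \<Rightarrow> 'b"
  assumes "CARD('b) = 5" "\<And>b. p (p b) = b"
  obtains (fix5) "\<And>b. p b = b"
    | (fix3) b1 b2 b3 b4 b5 where "distinct [b1, b2, b3, b4, b5]"
        "p b1 = b2" "p b2 = b1" "p b3 = b3" "p b4 = b4" "p b5 = b5"
    | (fix1) b1 b2 b3 b4 b5 where "distinct [b1, b2, b3, b4, b5]"
        "p b1 = b2" "p b2 = b1" "p b3 = b4" "p b4 = b3" "p b5 = b5"
proof (cases "\<forall>b. p b = b")
  case False
  then obtain b where b: "p b \<noteq> b" by blast
  define T where "T = - {b, p b}"
  have notin: "b \<notin> T" "p b \<notin> T" by (simp_all add: T_def)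
  have "card T = 3"
    using b assms(1) by (simp add: T_def Compl_eq_Diff_UNIV card_Diff_subset)
  moreover have "p c \<in> T" if "c \<in> T" for c
    using that assms(2)[of c] assms(2)[of b] by (auto simp: T_def)
  ultimately show ?thesis
  proof (rule involution_on_3)
    fix c d e assume "T = {c, d, e}" "distinct [c, d, e]" "p c = c" "p d = d" "p e = e"
    then show ?thesis using fix3[of b "p b" c d e] notin b by (simp add: assms(2))
  next
    fix c d e assume "T = {c, d, e}" "distinct [c, d, e]" "p c = d" "p d = c" "p e = e"
    then show ?thesis using fix1[of b "p b" c d e] notin b by (simp add: assms(2))
  qed (simp_all add: assms(2))
qed (use fix5 in blast)

section \<open>The matrix equations in rank five\<close>

text \<open>
  \<open>a\<close> and \<open>x\<close> are the matrices of \<open>V Rho1\<close> and \<open>V Rho2\<close>, and \<open>p\<close> is the permutation by which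
  \<open>V Psi\<close> acts, so that \<open>V Rho3\<close> has the entries \<open>x b (p c)\<close>.
\<close>

locale rS4_matrices =
  fixes p :: "'b::finite \<Rightarrow> 'b" and a x :: "'b \<Rightarrow> 'b \<Rightarrow> int"
  assumes card_5: "CARD('b) = 5"
    and p_p: "p (p b) = b"
    and a_nonneg: "0 \<le> a b c"
    and x_nonneg: "0 \<le> x b c"
    and a_sym: "a b c = a c b"
    and x_sym: "x b c = x c b"
    and a_p: "a b (p c) = a b c"
    and x_p: "x (p b) (p c) = x b c"
    and a_a: "(\<Sum>d\<in>UNIV. a b d * a d c) = of_bool (b = c) + of_bool (b = p c) + a b c"
    and a_x: "(\<Sum>d\<in>UNIV. a b d * x d c) = x b c + x b (p c)"
    and x_x: "(\<Sum>d\<in>UNIV. x b d * x d c) = of_bool (b = c) + a b c + x b c + x b (p c)"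
    and connected: "b \<noteq> c \<Longrightarrow> b \<noteq> p c \<Longrightarrow> a b c = 0 \<Longrightarrow> x b c = 0 \<Longrightarrow> 0 < x b (p c)"
begin

lemma UNIV_enum:
  assumes "distinct [b1, b2, b3, b4, b5 :: 'b]"
  shows "UNIV = {b1, b2, b3, b4, b5}"
  using card_subset_eq[of UNIV "set [b1, b2, b3, b4, b5]"] assms distinct_card[OF assms]
  by (simp add: card_5)

lemma sum_enum:
  assumes "distinct [b1, b2, b3, b4, b5 :: 'b]"
  shows "(\<Sum>d\<in>UNIV. f d) = f b1 + f b2 + f b3 + f b4 + (f b5 :: int)"
  unfolding UNIV_enum[OF assms] using assms by (simp add: add.assoc)

text \<open>At a fixed point \<open>c\<close> the entries of \<open>V Rho2\<close> and
  \<open>V Rho3\<close> coincide, so only \<open>V Rho2\<close> is left to link \<open>b\<close>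
  with \<open>c\<close>.\<close>

lemma connected_fixed: "p c = c \<Longrightarrow> b \<noteq> c \<Longrightarrow> a b c = 0 \<Longrightarrow> 0 < x b c"
  using connected[of b c] x_nonneg[of b c] by (cases "x b c = 0") auto

end

section \<open>Integer inequalities for the row equations\<close>

text \<open>With these bounds, linear arithmetic can solve the quadratic row equations.\<close>

lemma int_square_bounds:
  fixes n :: int
  shows "0 \<le> n * n" "n \<le> n * n" "3 * n - 2 \<le> n * n" "5 * n - 6 \<le> n * n"
proof -
  \<comment> \<open>Products of consecutive integers are nonnegative; \<open>k = 0, 1, 2\<close>
    yield the last three bounds.\<close>
  have "0 \<le> (n - k) * (n - (k + 1))" for k
    by (cases "n \<le> k") (auto intro: mult_nonneg_nonneg mult_nonpos_nonpos)
  from this[of 0] this[of 1] this[of 2] show "0 \<le> n * n" "n \<le> n * n" "3 * n - 2 \<le> n * n" "5 * n - 6 \<le> n * n"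
    by (simp_all add: algebra_simps)
qed

text \<open>This is the diagonal equation of a row of \<open>a\<close> when \<open>p\<close> has one
  fixed point: \<open>u\<close> and \<open>v\<close> each stand for two equal entries,
  \<open>w\<close> for the entry at the fixed point. The bound \<open>3 * u - 2 \<le> u * u\<close>
  gives \<open>u \<le> 1\<close>.\<close>

lemma norm_equation_solutions:
  fixes u v w :: int
  assumes "2 * (u * u) + 2 * (v * v) + w * w = 1 + u" "0 \<le> u" "0 \<le> v" "0 \<le> w"
  shows "v = 0 \<and> (u = 1 \<and> w = 0 \<or> u = 0 \<and> w = 1)"
proof -
  note sq = int_square_bounds[of u] int_square_bounds[of v] int_square_bounds[of w]
  have "u \<le> 1" using assms sq by linarith
  then consider "u = 0" | "u = 1" using assms(2) by linarith
  then show ?thesis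
  proof cases
    case 1
    then have "2 * (v * v) + w * w = 1" using assms(1) by simp
    moreover from this have "w \<in> {0, 1}" "v = 0" using assms(3,4) sq by auto
    ultimately show ?thesis using 1 by auto
  next
    case 2
    then have "2 * (v * v) + w * w = 0" using assms(1) by simp
    then have "w = 0" "v = 0" using assms(3,4) sq by linarith+
    with 2 show ?thesis by simp
  qed
qed

text \<open>Exactly one of the four numbers is 1, so both products vanish and the second equation
  excludes \<open>s\<close> and \<open>t\<close>.\<close>

lemma sum_one_solutions:
  fixes s t q r :: int
  assumes "s + t + q + r = 1" "2 * (s * t) + 2 * (q * r) = s + t" "0 \<le> s" "0 \<le> t" "0 \<le> q" "0 \<le> r"
  shows "s = 0 \<and> t = 0 \<and> (q = 1 \<and> r = 0 \<or> q = 0 \<and> r = 1)"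
proof -
  have "s \<in> {0, 1}" "t \<in> {0, 1}" "q \<in> {0, 1}" "r \<in> {0, 1}"
    using assms(1,3-6) by auto
  then show ?thesis using assms(1,2) by auto
qed

section \<open>Excluding three and five fixed points\<close>

context rS4_matrices
begin

text \<open>The diagonal equation of row \<open>b1\<close> of \<open>a\<close> leaves either an
  entry 1 on the 2-cycle or a single entry 1 at a fixed point. Both times the forced positive
  entries of \<open>x\<close> make some row too long for \<open>x_x\<close>.\<close>

lemma three_fixpoints_False:
  assumes B: "distinct [b1, b2, b3, b4, b5]"
    and p: "p b1 = b2" "p b2 = b1" "p b3 = b3" "p b4 = b4" "p b5 = b5"
  shows False
proof -
  note s = sum_enum[OF B]
  note sq = int_square_bounds
  have a: "a b1 b2 = a b1 b1" "a b2 b3 = a b1 b3" "a b2 b4 = a b1 b4" "a b2 b5 = a b1 b5"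
    using a_p[of b1 b1] a_p[of b3 b1] a_p[of b4 b1] a_p[of b5 b1] p by (simp_all add: a_sym)
  have x: "x b2 b3 = x b1 b3" "x b2 b4 = x b1 b4" "x b2 b5 = x b1 b5"
    using x_p[of b1 b3] x_p[of b1 b4] x_p[of b1 b5] p by simp_all
  have aa: "2 * (a b1 b1 * a b1 b1) + a b1 b3 * a b1 b3 + a b1 b4 * a b1 b4 + a b1 b5 * a b1 b5 = 1 + a b1 b1"
    using a_a[of b1 b1] p B unfolding s by (simp add: a_sym a)
  have pos: "a b1 c = 0 \<Longrightarrow> 0 < x b1 c" if "c \<in> {b3, b4, b5}" for c
    using connected_fixed[of c b1] that p B by auto
  have xx: "x b1 b1 * x b1 b1 + x b1 b2 * x b1 b2 + x b1 b3 * x b1 b3 + x b1 b4 * x b1 b4 + x b1 b5 * x b1 b5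
     = 1 + a b1 b1 + x b1 b1 + x b1 b2"
    using x_x[of b1 b1] p B unfolding s by (simp add: x_sym)
  \<comment> \<open>Here \<open>x\<close> is positive at all three fixed points, so the square sum
    of row \<open>b1\<close> exceeds \<open>2 + x b1 b1 + x b1 b2\<close>.\<close>
  have "False" if "a b1 b1 = 1"
  proof -
    have "a b1 b3 * a b1 b3 + a b1 b4 * a b1 b4 + a b1 b5 * a b1 b5 = 0"
      using aa that by simp
    then have "a b1 b3 = 0" "a b1 b4 = 0" "a b1 b5 = 0"
      by (smt (verit) mult_eq_0_iff zero_le_square)+
    then have "x b1 b3 > 0" "x b1 b4 > 0" "x b1 b5 > 0" using pos by auto
    then show False
      using xx that sq[of "x b1 b1"] sq[of "x b1 b2"] sq[of "x b1 b3"] sq[of "x b1 b4"] sq[of "x b1 b5"]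
      by linarith
  qed
  moreover have "False" if a0: "a b1 b1 = 0"
  proof -
    \<comment> \<open>Reading \<open>a_x\<close> at \<open>(b1, d)\<close> gives
      \<open>x c d = 2 * x b1 d \<ge> 2\<close>. Row \<open>d\<close> of \<open>x\<close> then has
      square sum at least \<open>6 + x d d * x d d\<close>, against at most
      \<open>3 + 2 * x d d\<close>.\<close>
    have key: False if C: "distinct [b1, b2, c, d, e]"
      and pc: "p c = c" "p d = d" and c: "a b1 c = 1" and d: "a b1 d = 0" and e: "a b1 e = 0" for c d e
    proof -
      note s = sum_enum[OF C]
      have x2d: "x b2 d = x b1 d"
        using x_p[of b1 d] p pc by simp
      have "x c d = 2 * x b1 d"
        using a_x[of b1 d] p C unfolding s by (simp add: a a0 c d e pc)
      moreover have "x b1 d > 0"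
        using connected_fixed[of d b1] d pc C by simp
      moreover have "2 * (x b1 d * x b1 d) + x c d * x c d + x d d * x d d + x d e * x d e
          = 1 + a d d + 2 * x d d"
        using x_x[of d d] C unfolding s by (simp add: pc x2d x_sym)
      moreover have "a d d \<le> 2"
      proof -
        have "a d d * a d d \<le> (\<Sum>f\<in>UNIV. a d f * a f d)"
          by (intro member_le_sum) (simp_all add: a_nonneg)
        then have "a d d * a d d \<le> 2 + a d d"
          using a_a[of d d] pc by simp
        then show ?thesis using sq[of "a d d"] by linarith
      qed
      ultimately show False
        using sq[of "x b1 d"] sq[of "x c d"] sq[of "x d d"] sq[of "x d e"] by linarith
    qed
    have "a b1 b3 * a b1 b3 + a b1 b4 * a b1 b4 + a b1 b5 * a b1 b5 = 1"
      using aa a0 by simp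
    moreover from this have "a b1 b3 \<in> {0, 1}" "a b1 b4 \<in> {0, 1}" "a b1 b5 \<in> {0, 1}"
      using sq[of "a b1 b3"] sq[of "a b1 b4"] sq[of "a b1 b5"] a_nonneg[of b1 b3]
        a_nonneg[of b1 b4] a_nonneg[of b1 b5]
      by auto
    ultimately consider "a b1 b3 = 1" "a b1 b4 = 0" "a b1 b5 = 0" | "a b1 b4 = 1" "a b1 b3 = 0" "a b1 b5 = 0"
      | "a b1 b5 = 1" "a b1 b3 = 0" "a b1 b4 = 0"
      by auto
    then show False
    proof cases
      case 1 then show False using key[of b3 b4 b5] B p by auto
    next
      case 2 then show False using key[of b4 b3 b5] B p by auto
    next
      case 3 then show False using key[of b5 b3 b4] B p by auto
    qed
  qed
  ultimately show False
    using aa sq[of "a b1 b1"] sq[of "a b1 b3"] sq[of "a b1 b4"] sq[of "a b1 b5"]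
      a_nonneg[of b1 b1] a_nonneg[of b1 b3] a_nonneg[of b1 b4] a_nonneg[of b1 b5]
    by linarith
qed

text \<open>Rows \<open>b2\<close> and \<open>b3\<close> of \<open>a\<close> overlap in
  \<open>b1\<close>, so \<open>a b2 b3\<close> is positive, which forces \<open>a b1 b1 = 0\<close>.
  Then \<open>a_x\<close> gives \<open>x b1 b2 + x b1 b3 = 2 * x b1 b1\<close>, and two further
  positive entries make row \<open>b1\<close> of \<open>x\<close> too long.\<close>

lemma all_fixed_not_adjacent:
  assumes B: "distinct [b1, b2, b3, b4, b5]"
    and p: "\<And>b. p b = b"
    and a: "a b1 b2 = 1" "a b1 b3 = 1" "a b1 b4 = 0" "a b1 b5 = 0"
  shows False
proof -
  note s = sum_enum[OF B] and sq = int_square_bounds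
  have pos: "0 < x b1 b4" "0 < x b1 b5"
    using connected_fixed[of _ b1] a p B by simp_all
  have aa: "1 + a b2 b2 * a b2 b3 + a b2 b3 * a b3 b3 + a b2 b4 * a b3 b4 + a b2 b5 * a b3 b5 = a b2 b3"
    using a_a[of b2 b3] p B unfolding s by (simp add: a a_sym)
  have "0 \<le> a b2 b2 * a b2 b3" "0 \<le> a b2 b3 * a b3 b3" "0 \<le> a b2 b4 * a b3 b4" "0 \<le> a b2 b5 * a b3 b5"
    by (simp_all add: a_nonneg)
  then have "1 \<le> a b2 b3" using aa by linarith
  moreover have "a b1 b1 + a b2 b2 + a b2 b3 = 1"
    using a_a[of b1 b2] p B unfolding s by (simp add: a a_sym)
  ultimately have a11: "a b1 b1 = 0"
    using a_nonneg[of b1 b1] a_nonneg[of b2 b2] by linarith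
  have "x b1 b2 + x b1 b3 = 2 * x b1 b1"
    using a_x[of b1 b1] p B unfolding s by (simp add: a a11 x_sym)
  moreover have "x b1 b1 * x b1 b1 + x b1 b2 * x b1 b2 + x b1 b3 * x b1 b3 + x b1 b4 * x b1 b4 + x b1 b5 * x b1 b5
     = 1 + 2 * x b1 b1"
    using x_x[of b1 b1] p B unfolding s by (simp add: a11 x_sym)
  ultimately show False
    using pos sq[of "x b1 b1"] sq[of "x b1 b2"] sq[of "x b1 b3"] sq[of "x b1 b4"] sq[of "x b1 b5"]
    by linarith
qed

text \<open>A diagonal entry 0 or 1 would leave square sum 2 for the other entries, hence exactly
  two ones, the configuration of \<open>all_fixed_not_adjacent\<close>.\<close>

lemma all_fixed_offdiag:
  assumes B: "distinct [b1, b2, b3, b4, b5]"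
    and p: "\<And>b. p b = b"
  shows "a b1 b2 = 0 \<and> a b1 b3 = 0 \<and> a b1 b4 = 0 \<and> a b1 b5 = 0 \<and> a b1 b1 = 2"
proof -
  note s = sum_enum[OF B] and sq = int_square_bounds
  have aa: "a b1 b1 * a b1 b1 + a b1 b2 * a b1 b2 + a b1 b3 * a b1 b3 + a b1 b4 * a b1 b4 + a b1 b5 * a b1 b5
     = 2 + a b1 b1"
    using a_a[of b1 b1] p B unfolding s by (simp add: a_sym)
  note nn = a_nonneg[of b1 b1] a_nonneg[of b1 b2] a_nonneg[of b1 b3] a_nonneg[of b1 b4] a_nonneg[of b1 b5]
  note b = sq[of "a b1 b1"] sq[of "a b1 b2"] sq[of "a b1 b3"] sq[of "a b1 b4"] sq[of "a b1 b5"]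
  have "a b1 b1 \<le> 2" using aa nn b by linarith
  then consider "a b1 b1 = 2" | "a b1 b1 = 0 \<or> a b1 b1 = 1" using nn by linarith
  then show ?thesis
  proof cases
    case 1
    then show ?thesis using aa nn b by auto
  next
    case 2
    then have "a b1 b2 * a b1 b2 + a b1 b3 * a b1 b3 + a b1 b4 * a b1 b4 + a b1 b5 * a b1 b5 = 2"
      using aa by auto
    moreover from this have "a b1 b2 \<in> {0, 1}" "a b1 b3 \<in> {0, 1}" "a b1 b4 \<in> {0, 1}" "a b1 b5 \<in> {0, 1}"
      using nn b by auto
    ultimately have False
      \<comment> \<open>One instance for each pair of positions of the two ones.\<close>
      using all_fixed_not_adjacent[of b1 b2 b3 b4 b5] all_fixed_not_adjacent[of b1 b2 b4 b3 b5]
        all_fixed_not_adjacent[of b1 b2 b5 b3 b4] all_fixed_not_adjacent[of b1 b3 b4 b2 b5]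
        all_fixed_not_adjacent[of b1 b3 b5 b2 b4] all_fixed_not_adjacent[of b1 b4 b5 b2 b3] B p
      by auto
    then show ?thesis ..
  qed
qed

text \<open>Now \<open>a\<close> is twice the identity and the row norms force every entry of
  \<open>x\<close> to be 1, but then an off-diagonal entry of the square of \<open>x\<close> is 5
  instead of 2.\<close>

lemma all_fixed_False:
  assumes p: "\<And>b. p b = b"
  shows False
proof -
  note sq = int_square_bounds
  obtain b1 b2 b3 b4 b5 :: 'b where B: "distinct [b1, b2, b3, b4, b5]"
  proof -
    obtain bs :: "'b list" where bs: "set bs = UNIV" "distinct bs"
      using finite_distinct_list[OF finite[of UNIV]] by auto
    then have "length bs = 5" using distinct_card[OF bs(2)] card_5 by simp
    then obtain b1 b2 b3 b4 b5 where "bs = [b1, b2, b3, b4, b5]"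
      by (auto simp: length_Suc_conv numeral_eq_Suc)
    with bs(2) have "distinct [b1, b2, b3, b4, b5]" by simp
    then show ?thesis using that by blast
  qed
  have row: "x c1 c1 = 1 \<and> x c1 c2 = 1 \<and> x c1 c3 = 1 \<and> x c1 c4 = 1 \<and> x c1 c5 = 1"
    if C: "distinct [c1, c2, c3, c4, c5]" for c1 c2 c3 c4 c5
  proof -
    note a = all_fixed_offdiag[OF C p]
    have pos: "0 < x c1 d" if "d \<in> {c2, c3, c4, c5}" for d
      using connected_fixed[of d c1] a p C that by auto
    \<comment> \<open>The four positive off-diagonal entries thus have square sum
      \<open>4 - (x c1 c1 - 1)^2\<close>.\<close>
    have "x c1 c1 * x c1 c1 + x c1 c2 * x c1 c2 + x c1 c3 * x c1 c3 + x c1 c4 * x c1 c4 + x c1 c5 * x c1 c5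
       = 3 + 2 * x c1 c1"
      using x_x[of c1 c1] p a C unfolding sum_enum[OF C] by (simp add: x_sym)
    then show ?thesis
      using pos[of c2] pos[of c3] pos[of c4] pos[of c5] sq[of "x c1 c1"] sq[of "x c1 c2"]
        sq[of "x c1 c3"] sq[of "x c1 c4"] sq[of "x c1 c5"] by auto
  qed
  have "distinct [b2, b1, b3, b4, b5]" using B by auto
  note r = row[OF B] row[OF this]
  show False
    using x_x[of b1 b2] p all_fixed_offdiag[OF B p] r B unfolding sum_enum[OF B]
    by (simp add: x_sym)
qed

section \<open>Solving the equations for one fixed point\<close>

text \<open>Rewriting to normal form: \<open>a\<close> is invariant under \<open>p\<close> in each
  index, \<open>x\<close> under \<open>p\<close> in both indices together, which leaves six unknowns
  for \<open>a\<close> and nine for \<open>x\<close>.\<close>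

lemma one_fixpoint_sym:
  assumes p: "p b1 = b2" "p b2 = b1" "p b3 = b4" "p b4 = b3" "p b5 = b5"
  shows "a b b2 = a b b1" "a b2 b = a b1 b" "a b b4 = a b b3" "a b4 b = a b3 b"
    "a b3 b1 = a b1 b3" "a b5 b1 = a b1 b5" "a b5 b3 = a b3 b5"
    "x b2 b2 = x b1 b1" "x b2 b1 = x b1 b2" "x b4 b4 = x b3 b3" "x b4 b3 = x b3 b4"
    "x b2 b4 = x b1 b3" "x b4 b2 = x b1 b3" "x b3 b1 = x b1 b3"
    "x b2 b3 = x b1 b4" "x b3 b2 = x b1 b4" "x b4 b1 = x b1 b4"
    "x b2 b5 = x b1 b5" "x b5 b2 = x b1 b5" "x b5 b1 = x b1 b5"
    "x b4 b5 = x b3 b5" "x b5 b4 = x b3 b5" "x b5 b3 = x b3 b5"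
proof -
  show a1: "a b b2 = a b b1" for b using a_p[of b b1] p by simp
  show a3: "a b b4 = a b b3" for b using a_p[of b b3] p by simp
  show "a b2 b = a b1 b" "a b4 b = a b3 b"
    using a1[of b] a3[of b] by (simp_all only: a_sym[of _ b])
  show "a b3 b1 = a b1 b3" "a b5 b1 = a b1 b5" "a b5 b3 = a b3 b5"
    by (rule a_sym)+
  have x: "x b2 b2 = x b1 b1" "x b4 b4 = x b3 b3" "x b2 b4 = x b1 b3" "x b2 b3 = x b1 b4"
    "x b2 b5 = x b1 b5" "x b4 b5 = x b3 b5"
    using x_p[of b1 b1] x_p[of b3 b3] x_p[of b1 b3] x_p[of b1 b4] x_p[of b1 b5] x_p[of b3 b5] p
    by simp_all
  then show "x b2 b2 = x b1 b1" "x b4 b4 = x b3 b3" "x b2 b4 = x b1 b3" "x b2 b3 = x b1 b4"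
    "x b2 b5 = x b1 b5" "x b4 b5 = x b3 b5"
    by blast+
  show "x b2 b1 = x b1 b2" "x b4 b3 = x b3 b4" "x b3 b1 = x b1 b3" "x b4 b1 = x b1 b4"
    "x b5 b1 = x b1 b5" "x b5 b3 = x b3 b5"
    by (rule x_sym)+
  show "x b4 b2 = x b1 b3" "x b3 b2 = x b1 b4" "x b5 b2 = x b1 b5" "x b5 b4 = x b3 b5"
    using x x_sym[of b4 b2] x_sym[of b3 b2] x_sym[of b5 b2] x_sym[of b5 b4] by simp_all
qed

text \<open>By the norm equations each 2-cycle either carries a block of ones or is joined by ones
  to \<open>b5\<close>, and the norm of row \<open>b5\<close> forbids joining both. The last
  alternative is the second with the 2-cycles exchanged.\<close>

lemma one_fixpoint_a:
  assumes B: "distinct [b1, b2, b3, b4, b5]"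
    and p: "p b1 = b2" "p b2 = b1" "p b3 = b4" "p b4 = b3" "p b5 = b5"
  shows "a b1 b3 = 0"
    "a b1 b1 = 1 \<and> a b1 b5 = 0 \<and> a b3 b3 = 1 \<and> a b3 b5 = 0 \<and> a b5 b5 = 2 \<or>
     a b1 b1 = 0 \<and> a b1 b5 = 1 \<and> a b3 b3 = 1 \<and> a b3 b5 = 0 \<and> a b5 b5 = 1 \<or>
     a b1 b1 = 1 \<and> a b1 b5 = 0 \<and> a b3 b3 = 0 \<and> a b3 b5 = 1 \<and> a b5 b5 = 1"
proof -
  note sq = int_square_bounds[of "a b1 b1"] int_square_bounds[of "a b1 b3"] int_square_bounds[of "a b1 b5"]
    int_square_bounds[of "a b3 b3"] int_square_bounds[of "a b3 b5"] int_square_bounds[of "a b5 b5"]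
  note nn = a_nonneg[of b1 b1] a_nonneg[of b1 b3] a_nonneg[of b1 b5] a_nonneg[of b3 b3]
    a_nonneg[of b3 b5] a_nonneg[of b5 b5]
  note sym = one_fixpoint_sym[OF p]
  have 11: "2 * (a b1 b1 * a b1 b1) + 2 * (a b1 b3 * a b1 b3) + a b1 b5 * a b1 b5 = 1 + a b1 b1"
    using a_a[of b1 b1] p B unfolding sum_enum[OF B] by (simp add: sym)
  have 33: "2 * (a b3 b3 * a b3 b3) + 2 * (a b1 b3 * a b1 b3) + a b3 b5 * a b3 b5 = 1 + a b3 b3"
    using a_a[of b3 b3] p B unfolding sum_enum[OF B] by (simp add: sym)
  have 55: "2 * (a b1 b5 * a b1 b5) + 2 * (a b3 b5 * a b3 b5) + a b5 b5 * a b5 b5 = 2 + a b5 b5"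
    using a_a[of b5 b5] p B unfolding sum_enum[OF B] by (simp add: sym)
  have 15: "2 * (a b1 b1 * a b1 b5) + 2 * (a b1 b3 * a b3 b5) + a b1 b5 * a b5 b5 = a b1 b5"
    using a_a[of b1 b5] p B unfolding sum_enum[OF B] by (simp add: sym)
  have 35: "2 * (a b1 b3 * a b1 b5) + 2 * (a b3 b3 * a b3 b5) + a b3 b5 * a b5 b5 = a b3 b5"
    using a_a[of b3 b5] p B unfolding sum_enum[OF B] by (simp add: sym)
  have 1: "a b1 b1 = 1 \<and> a b1 b5 = 0 \<and> a b1 b3 = 0 \<or> a b1 b1 = 0 \<and> a b1 b5 = 1 \<and> a b1 b3 = 0"
    using norm_equation_solutions[OF 11] nn by simp
  moreover have 3: "a b3 b3 = 1 \<and> a b3 b5 = 0 \<or> a b3 b3 = 0 \<and> a b3 b5 = 1"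
    using norm_equation_solutions[OF 33] nn by simp
  moreover have "a b5 b5 = 2" if "a b1 b5 = 0" "a b3 b5 = 0"
  proof -
    have eq: "a b5 b5 * a b5 b5 = 2 + a b5 b5" using 55 that by simp
    then have "a b5 b5 \<in> {0, 1, 2}" using nn sq by auto
    with eq show ?thesis by auto
  qed
  moreover have "a b5 b5 = 1" if "a b1 b1 = 0" "a b1 b5 = 1" "a b1 b3 = 0"
    using 15 that by simp
  moreover have "a b5 b5 = 1" if "a b3 b3 = 0" "a b3 b5 = 1" "a b1 b3 = 0"
    using 35 that by simp
  \<comment> \<open>This would mean \<open>4 + n * n = 2 + n\<close> for \<open>n = a b5 b5\<close>,
    whose bounds are items 21 and 22 of \<open>sq\<close>.\<close>
  moreover have False if "a b1 b5 = 1" "a b3 b5 = 1"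
    using 55 that sq(21,22) by simp
  ultimately show "a b1 b3 = 0"
    "a b1 b1 = 1 \<and> a b1 b5 = 0 \<and> a b3 b3 = 1 \<and> a b3 b5 = 0 \<and> a b5 b5 = 2 \<or>
     a b1 b1 = 0 \<and> a b1 b5 = 1 \<and> a b3 b3 = 1 \<and> a b3 b5 = 0 \<and> a b5 b5 = 1 \<or>
     a b1 b1 = 1 \<and> a b1 b5 = 0 \<and> a b3 b3 = 0 \<and> a b3 b5 = 1 \<and> a b5 b5 = 1"
    by blast+
qed

text \<open>No entry of \<open>a\<close> joins different orbits of \<open>p\<close>, so
  \<open>x\<close> is positive between \<open>b5\<close> and the rest, and its norm fixes row
  \<open>b5\<close>. The entries at \<open>(b1, b5)\<close> and \<open>(b3, b5)\<close> of
  \<open>x_x\<close> then leave sum 1 for the rest of rows \<open>b1\<close> and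
  \<open>b3\<close>.\<close>

lemma one_fixpoint_x_split:
  assumes B: "distinct [b1, b2, b3, b4, b5]"
    and p: "p b1 = b2" "p b2 = b1" "p b3 = b4" "p b4 = b3" "p b5 = b5"
    and a: "a b1 b3 = 0" "a b1 b1 = 1" "a b1 b5 = 0" "a b3 b3 = 1" "a b3 b5 = 0" "a b5 b5 = 2"
  shows "x b1 b1 = 0" "x b1 b2 = 0" "x b3 b3 = 0" "x b3 b4 = 0" "x b1 b5 = 1" "x b3 b5 = 1"
    "x b5 b5 = 1" "x b1 b3 = 1 \<and> x b1 b4 = 0 \<or> x b1 b3 = 0 \<and> x b1 b4 = 1"
proof -
  note sym = one_fixpoint_sym[OF p]
  have pos: "0 < x b1 b5" "0 < x b3 b5"
    using connected_fixed[of b5] p(5) a B by simp_all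
  have "2 * (x b1 b5 * x b1 b5) + 2 * (x b3 b5 * x b3 b5) + x b5 b5 * x b5 b5 = 3 + 2 * x b5 b5"
    using x_x[of b5 b5] p B a unfolding sum_enum[OF B] by (simp add: sym)
  then show x5: "x b1 b5 = 1" "x b3 b5 = 1" "x b5 b5 = 1"
    using pos int_square_bounds[of "x b1 b5"] int_square_bounds[of "x b3 b5"]
      int_square_bounds[of "x b5 b5"] by linarith+
  have "x b1 b1 + x b1 b2 + x b1 b3 + x b1 b4 = 1"
    using x_x[of b1 b5] p B a unfolding sum_enum[OF B] by (simp add: sym x5)
  moreover have "x b3 b3 + x b3 b4 + x b1 b3 + x b1 b4 = 1"
    using x_x[of b3 b5] p B a unfolding sum_enum[OF B] by (simp add: sym x5)
  moreover have "2 * (x b1 b1 * x b1 b2) + 2 * (x b1 b3 * x b1 b4) = x b1 b1 + x b1 b2"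
    using x_x[of b1 b2] p B a unfolding sum_enum[OF B] by (simp add: sym x5)
  moreover have "2 * (x b3 b3 * x b3 b4) + 2 * (x b1 b3 * x b1 b4) = x b3 b3 + x b3 b4"
    using x_x[of b3 b4] p B a unfolding sum_enum[OF B] by (simp add: sym x5)
  ultimately show "x b1 b1 = 0" "x b1 b2 = 0" "x b3 b3 = 0" "x b3 b4 = 0"
    "x b1 b3 = 1 \<and> x b1 b4 = 0 \<or> x b1 b3 = 0 \<and> x b1 b4 = 1"
    using sum_one_solutions[of "x b1 b1" "x b1 b2" "x b1 b3" "x b1 b4"]
      sum_one_solutions[of "x b3 b3" "x b3 b4" "x b1 b3" "x b1 b4"]
    by (simp_all add: x_nonneg)
qed

text \<open>Row \<open>b1\<close> of \<open>a\<close> is the unit vector at \<open>b5\<close>, so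
  \<open>a_x\<close> expresses column \<open>b5\<close> of \<open>x\<close> by entries of row
  \<open>b1\<close>. Positivity of \<open>x b3 b5\<close> then uses up the norm of row
  \<open>b1\<close>, so that \<open>x b1 b1\<close> and \<open>x b1 b2\<close> vanish.\<close>

lemma one_fixpoint_x_triangle:
  assumes B: "distinct [b1, b2, b3, b4, b5]"
    and p: "p b1 = b2" "p b2 = b1" "p b3 = b4" "p b4 = b3" "p b5 = b5"
    and a: "a b1 b3 = 0" "a b1 b1 = 0" "a b1 b5 = 1" "a b3 b3 = 1" "a b3 b5 = 0" "a b5 b5 = 1"
  shows "x b1 b1 = 0" "x b1 b2 = 0" "x b3 b3 = 1" "x b3 b4 = 1" "x b1 b5 = 0" "x b3 b5 = 1"
    "x b5 b5 = 0" "x b1 b3 = 1 \<and> x b1 b4 = 0 \<or> x b1 b3 = 0 \<and> x b1 b4 = 1"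
proof -
  note sym = one_fixpoint_sym[OF p]
  let ?s = "x b1 b1" and ?t = "x b1 b2" and ?q = "x b1 b3" and ?r = "x b1 b4"
    and ?s' = "x b3 b3" and ?t' = "x b3 b4"
  have x15: "x b1 b5 = ?s + ?t"
    using a_x[of b1 b1] p B a unfolding sum_enum[OF B] by (simp add: sym)
  have x35: "x b3 b5 = ?q + ?r"
    using a_x[of b1 b3] p B a unfolding sum_enum[OF B] by (simp add: sym)
  have x55: "x b5 b5 = 2 * (?s + ?t)"
    using a_x[of b1 b5] p B a unfolding sum_enum[OF B] by (simp add: sym x15)
  have nn: "0 \<le> ?s" "0 \<le> ?t" "0 \<le> ?q" "0 \<le> ?r" "0 \<le> ?s'" "0 \<le> ?t'"
    by (simp_all add: x_nonneg)
  have pos: "0 < ?q + ?r"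
    using connected_fixed[of b5 b3] p(5) a B by (simp add: x35)
  have 11: "?s * ?s + ?t * ?t + ?q * ?q + ?r * ?r + (?s + ?t) * (?s + ?t) = 1 + ?s + ?t"
    using x_x[of b1 b1] p B a unfolding sum_enum[OF B] by (simp add: sym x15)
  have 33: "?q * ?q + ?r * ?r + ?s' * ?s' + ?t' * ?t' + (?q + ?r) * (?q + ?r) = 2 + ?s' + ?t'"
    using x_x[of b3 b3] p B a unfolding sum_enum[OF B] by (simp add: sym x35)
  have "1 \<le> ?q * ?q + ?r * ?r"
    using pos nn int_square_bounds[of ?q] int_square_bounds[of ?r] by linarith
  with 11 nn have st: "?s = 0" "?t = 0"
    using int_square_bounds[of ?s] int_square_bounds[of ?t] int_square_bounds[of "?s + ?t"] by linarith+
  then have qr1: "?q * ?q + ?r * ?r = 1" using 11 by simp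
  then have "?q \<in> {0, 1}" "?r \<in> {0, 1}"
    using nn int_square_bounds[of ?q] int_square_bounds[of ?r] by auto
  with qr1 show qr: "?q = 1 \<and> ?r = 0 \<or> ?q = 0 \<and> ?r = 1" by auto
  have "?s' + ?t' = 2"
    using x_x[of b3 b5] p B a qr unfolding sum_enum[OF B] by (auto simp: sym x15 x35 x55 st)
  \<comment> \<open>Sum 2 together with square sum 2, from \<open>33\<close>, leaves only two
    ones.\<close>
  with 33 qr show "?s' = 1" "?t' = 1"
    using int_square_bounds[of ?s'] int_square_bounds[of ?t'] by auto
  show "?s = 0" "?t = 0" "x b1 b5 = 0" "x b3 b5 = 1" "x b5 b5 = 0"
    using st qr by (auto simp: x15 x35 x55)
qed

text \<open>The alternatives \<open>triangle\<close> and \<open>split\<close> carry the matrices of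
  \<open>M51\<close> and \<open>M52\<close>. If \<open>x b1 b3\<close> is 1 instead of
  \<open>x b1 b4\<close>, the names \<open>b3\<close> and \<open>b4\<close> are
  interchanged.\<close>

theorem classification:
  obtains
    (triangle) b1 b2 b3 b4 b5 where "distinct [b1, b2, b3, b4, b5]"
      "map p [b1, b2, b3, b4, b5] = [b2, b1, b4, b3, b5]"
      "map (\<lambda>b. map (a b) [b1, b2, b3, b4, b5]) [b1, b2, b3, b4, b5] =
        [[0, 0, 0, 0, 1], [0, 0, 0, 0, 1], [0, 0, 1, 1, 0], [0, 0, 1, 1, 0], [1, 1, 0, 0, 1]]"
      "map (\<lambda>b. map (x b) [b1, b2, b3, b4, b5]) [b1, b2, b3, b4, b5] =
        [[0, 0, 0, 1, 0], [0, 0, 1, 0, 0], [0, 1, 1, 1, 1], [1, 0, 1, 1, 1], [0, 0, 1, 1, 0]]"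
  | (split) b1 b2 b3 b4 b5 where "distinct [b1, b2, b3, b4, b5]"
      "map p [b1, b2, b3, b4, b5] = [b2, b1, b4, b3, b5]"
      "map (\<lambda>b. map (a b) [b1, b2, b3, b4, b5]) [b1, b2, b3, b4, b5] =
        [[1, 1, 0, 0, 0], [1, 1, 0, 0, 0], [0, 0, 1, 1, 0], [0, 0, 1, 1, 0], [0, 0, 0, 0, 2]]"
      "map (\<lambda>b. map (x b) [b1, b2, b3, b4, b5]) [b1, b2, b3, b4, b5] =
        [[0, 0, 0, 1, 1], [0, 0, 1, 0, 1], [0, 1, 0, 0, 1], [1, 0, 0, 0, 1], [1, 1, 1, 1, 1]]"
proof -
  have T: thesis
    if B: "distinct [b1, b2, b3, b4, b5]"
      and p: "p b1 = b2" "p b2 = b1" "p b3 = b4" "p b4 = b3" "p b5 = b5"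
      and a: "a b1 b3 = 0" "a b1 b1 = 0" "a b1 b5 = 1" "a b3 b3 = 1" "a b3 b5 = 0" "a b5 b5 = 1"
    for b1 b2 b3 b4 b5
    using one_fixpoint_x_triangle(8)[OF that]
  proof
    assume "x b1 b3 = 1 \<and> x b1 b4 = 0"
    moreover have "b4 \<noteq> b3" using B by auto
    ultimately show thesis
      using B p a one_fixpoint_x_triangle(1-7)[OF that]
      by (intro triangle[of b1 b2 b4 b3 b5]) (simp_all add: one_fixpoint_sym[OF p])
  next
    assume "x b1 b3 = 0 \<and> x b1 b4 = 1"
    then show thesis
      using B p a one_fixpoint_x_triangle(1-7)[OF that]
      by (intro triangle[of b1 b2 b3 b4 b5]) (simp_all add: one_fixpoint_sym[OF p])
  qed
  have S: thesis
    if B: "distinct [b1, b2, b3, b4, b5]"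
      and p: "p b1 = b2" "p b2 = b1" "p b3 = b4" "p b4 = b3" "p b5 = b5"
      and a: "a b1 b3 = 0" "a b1 b1 = 1" "a b1 b5 = 0" "a b3 b3 = 1" "a b3 b5 = 0" "a b5 b5 = 2"
    for b1 b2 b3 b4 b5
    using one_fixpoint_x_split(8)[OF that]
  proof
    assume "x b1 b3 = 1 \<and> x b1 b4 = 0"
    moreover have "b4 \<noteq> b3" using B by auto
    ultimately show thesis
      using B p a one_fixpoint_x_split(1-7)[OF that]
      by (intro split[of b1 b2 b4 b3 b5]) (simp_all add: one_fixpoint_sym[OF p])
  next
    assume "x b1 b3 = 0 \<and> x b1 b4 = 1"
    then show thesis
      using B p a one_fixpoint_x_split(1-7)[OF that]
      by (intro split[of b1 b2 b3 b4 b5]) (simp_all add: one_fixpoint_sym[OF p])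
  qed
  from card_5 p_p show thesis
  proof (cases rule: involution_on_5)
    case fix5
    then show thesis using all_fixed_False by blast
  next
    case fix3
    then show thesis using three_fixpoints_False by blast
  next
    case (fix1 b1 b2 b3 b4 b5)
    \<comment> \<open>Exchanging the 2-cycles reduces the third alternative of
      \<open>one_fixpoint_a\<close> to \<open>T\<close>.\<close>
    have "distinct [b3, b4, b1, b2, b5]" using fix1(1) by auto
    moreover have "a b3 b1 = 0" using one_fixpoint_a(1)[OF fix1] by (simp add: a_sym)
    ultimately show thesis
      using one_fixpoint_a[OF fix1] S[OF fix1] T[OF fix1] T[of b3 b4 b1 b2 b5] fix1(2-)
      by blast
  qed
qed

end

section \<open>From the module to its matrices and back\<close>

text \<open>Each column has square sum 1, so it has a single nonzero entry, equal to 1.\<close>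

lemma involution_matrix:
  fixes P :: "'b::finite \<Rightarrow> 'b \<Rightarrow> int"
  assumes nonneg: "\<And>b c. 0 \<le> P b c" and sym: "\<And>b c. P b c = P c b"
    and square: "\<And>b c. (\<Sum>d\<in>UNIV. P b d * P d c) = of_bool (b = c)"
  shows "\<exists>p. \<forall>b c. P b c = of_bool (b = p c)"
proof -
  have "\<exists>d. \<forall>b. P b c = of_bool (b = d)" for c
  proof -
    have one: "(\<Sum>d\<in>UNIV. P d c * P d c) = 1"
      using square[of c c] by (simp add: sym[of c])
    then have "\<exists>d. P d c \<noteq> 0" by (rule_tac ccontr) simp
    then obtain d where d: "P d c \<noteq> 0" by blast
    have "(\<Sum>b\<in>UNIV - {d}. P b c * P b c) = 1 - P d c * P d c"
      using one by (simp add: sum.remove[of UNIV d])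
    moreover have "P d c \<le> P d c * P d c" "0 \<le> (\<Sum>b\<in>UNIV - {d}. P b c * P b c)"
      by (simp_all add: int_square_bounds sum_nonneg)
    moreover have "1 \<le> P d c"
      using d nonneg[of d c] by simp
    ultimately have 1: "P d c = 1" and 0: "(\<Sum>b\<in>UNIV - {d}. P b c * P b c) = 0"
      by (smt (verit) mult_cancel_right1)+
    from 0 have "P b c = 0" if "b \<noteq> d" for b
      using that by (simp add: sum_nonneg_eq_0_iff)
    with 1 have "\<forall>b. P b c = of_bool (b = d)" by simp
    then show ?thesis ..
  qed
  then show ?thesis by metis
qed

text \<open>Indexing the basis turns the ring relations \<open>V_products\<close> and irreducibility
  into the assumptions of \<open>rS4_matrices\<close>.\<close>

lemma (in based_module) rS4_matrices_coeff:
  fixes e :: "'b::finite \<Rightarrow> 'm"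
  assumes irr: "irreducible_zplus_module act B" and e: "bij_betw e UNIV B" and card: "CARD('b) = 5"
  obtains p where "rS4_matrices p (\<lambda>b c. coeff (V Rho1) (e b) (e c)) (\<lambda>b c. coeff (V Rho2) (e b) (e c))"
    and "\<And>b c. coeff (V Triv) (e b) (e c) = of_bool (b = c)"
    and "\<And>b c. coeff (V Psi) (e b) (e c) = of_bool (b = p c)"
    and "\<And>b c. coeff (V Rho3) (e b) (e c) = coeff (V Rho2) (e b) (e (p c))"
proof -
  define m where "m r b c = coeff r (e b) (e c)" for r b c
  have e_in: "e b \<in> B" for b using e by (auto simp: bij_betw_def)
  have e_eq: "e b = e c \<longleftrightarrow> b = c" for b c using e by (auto simp: bij_betw_def inj_eq)
  have fin: "finite B" using bij_betw_finite[OF e] by simp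
  have mult: "m (r * s) b c = (\<Sum>d\<in>UNIV. m s b d * m r d c)" for r s b c
    by (simp add: m_def coeff_mult[OF fin] flip: sum.reindex_bij_betw[OF e])
  have add: "m (r + s) b c = m r b c + m s b c" for r s b c
    by (simp add: m_def coeff_add)
  have one: "m 1 b c = of_bool (b = c)" for b c
    by (simp add: m_def coeff_1 e_in e_eq)
  have nonneg: "0 \<le> m (V i) b c" for i b c
    by (simp add: m_def coeff_nonneg e_in)
  have sym: "m (V i) b c = m (V i) c b" for i b c
    by (simp add: m_def coeff_def symmetric e_in)
  have "(\<Sum>d\<in>UNIV. m (V Psi) b d * m (V Psi) d c) = of_bool (b = c)" for b c
    by (simp add: V_products one flip: mult)
  from involution_matrix[of "m (V Psi)", OF nonneg sym this]
  obtain p where Psi: "\<And>b c. m (V Psi) b c = of_bool (b = p c)"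
    by blast
  \<comment> \<open>Symmetry of the permutation matrix makes \<open>p\<close> its own
    inverse.\<close>
  have p_p: "p (p b) = b" for b
    using sym[of Psi "p b" b] by (simp add: Psi)
  \<comment> \<open>By the reversed order in \<open>mult\<close>, a left factor \<open>V Psi\<close>
    permutes the column index.\<close>
  have right_p: "m (V Psi * r) b c = m r b (p c)" for r b c
    by (simp add: mult Psi if_distrib of_bool_def cong: if_cong)
  have Rho3: "m (V Rho3) b c = m (V Rho2) b (p c)" for b c
    by (simp add: right_p flip: V_products)
  have "rS4_matrices p (m (V Rho1)) (m (V Rho2))"
  proof
    fix b c
    show "m (V Rho1) b (p c) = m (V Rho1) b c"
      using right_p[of "V Rho1"] by (simp add: V_products)
    \<comment> \<open>This is the symmetry of the matrix of \<open>V Rho3\<close>.\<close>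
    show "m (V Rho2) (p b) (p c) = m (V Rho2) b c"
      using sym[of Rho3 "p b" c] by (simp add: Rho3 p_p sym[of Rho2 c])
    show "(\<Sum>d\<in>UNIV. m (V Rho1) b d * m (V Rho1) d c) = of_bool (b = c) + of_bool (b = p c) + m (V Rho1) b c"
      by (simp add: V_products add one Psi flip: mult)
    show "(\<Sum>d\<in>UNIV. m (V Rho1) b d * m (V Rho2) d c) = m (V Rho2) b c + m (V Rho2) b (p c)"
      by (simp add: mult.commute[of "V Rho2"] V_products add Rho3 flip: mult)
    show "(\<Sum>d\<in>UNIV. m (V Rho2) b d * m (V Rho2) d c) =
        of_bool (b = c) + m (V Rho1) b c + m (V Rho2) b c + m (V Rho2) b (p c)"
      by (simp add: V_products add one Rho3 flip: mult)
    assume "b \<noteq> c" "b \<noteq> p c" "m (V Rho1) b c = 0" "m (V Rho2) b c = 0"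
    moreover obtain i where "m (V i) b c \<noteq> 0"
      using irreducible_zplus_module.coeff_connected[OF irr fin e_in e_in] by (auto simp: m_def)
    \<comment> \<open>The four assumptions exclude a link by any other irreducible
      representation.\<close>
    ultimately have "m (V Rho3) b c \<noteq> 0"
      by (cases i) (auto simp: V_Triv one Psi)
    then show "0 < m (V Rho2) b (p c)"
      using nonneg[of Rho3 b c] by (simp add: Rho3)
  qed (fact card p_p nonneg sym)+
  moreover have "m r = (\<lambda>b c. coeff r (e b) (e c))" for r
    by (simp add: fun_eq_iff m_def)
  ultimately show ?thesis
    using one Psi Rho3 by (intro that[of p]) (simp_all add: V_Triv)
qed

text \<open>As \<open>h\<close> lists \<open>B\<close> in the order of the coordinates, the
  bijection of bases sends \<open>b\<close> to the unit vector at \<open>inv h b\<close>.\<close>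

lemma zplus_equivalent_standard_basis:
  fixes act' :: "rS4 \<Rightarrow> int^'n::finite \<Rightarrow> int^'n" and h :: "'n \<Rightarrow> 'm::ab_group_add"
  assumes act: "zplus_module act B" and act': "zplus_module act' standard_basis"
    and of_int: "\<And>n v. act' (of_int n) v = n *s v"
    and h: "bij_betw h UNIV B"
    and coeff: "\<And>i j k. zplus_module.coeff act B (V i) (h j) (h k) = act' (V i) (axis j 1) $ k"
  shows "zplus_equivalent act B act' standard_basis"
proof (rule zplus_equivalentI[OF act act'])
  have inv: "inv h (h j) = j" for j
    using h by (simp add: bij_betw_def)
  have range: "range h = B"
    using h by (simp add: bij_betw_def)
  show "finite B"
    using bij_betw_finite[OF h] by simp
  have "bij_betw (\<lambda>j. axis j 1 :: int^'n) UNIV standard_basis"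
    by (auto simp: bij_betw_def standard_basis_def inj_def axis_eq_axis)
  from bij_betw_trans[OF bij_betw_inv_into[OF h] this]
  show "bij_betw (\<lambda>b. axis (inv h b) 1) B (standard_basis :: (int^'n) set)"
    by (simp add: comp_def)
  fix i b c assume "b \<in> B" "c \<in> B"
  then obtain j k where [simp]: "b = h j" "c = h k"
    using range by blast
  \<comment> \<open>Integers act by scaling vectors, so coefficients in the standard basis are
    vector components.\<close>
  have "(\<lambda>n. act' (of_int n)) = (*s)"
    by (simp add: fun_eq_iff of_int)
  then have "zplus_module.coeff act' standard_basis (V i) (axis j 1) (axis k 1) = act' (V i) (axis j 1) $ k"
    by (simp add: zplus_module.coeff_def[OF act'] representation_standard_basis)
  then show "zplus_module.coeff act' standard_basis (V i) (axis (inv h b) 1) (axis (inv h c) 1)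
      = zplus_module.coeff act B (V i) b c"
    by (simp add: inv coeff)
qed

text \<open>Serves to reorder the index type \<open>5\<close>, the vector being read as the function
  listing its entries.\<close>

lemma bij_vector_5:
  assumes "distinct [b1, b2, b3, b4, b5 :: 5]"
  shows "bij (($) (vector [b1, b2, b3, b4, b5] :: 5^5))"
proof -
  let ?v = "vector [b1, b2, b3, b4, b5] :: 5^5"
  have "\<forall>j k. ?v $ j = ?v $ k \<longrightarrow> j = k"
    unfolding all_5 vector_5 using assms by auto
  then have "inj (($) ?v)" by (simp add: inj_def)
  then show ?thesis by (simp add: bij_def finite_UNIV_inj_surj)
qed

theorem proposition3p5:
  fixes act :: "rS4 \<Rightarrow> 'm::ab_group_add \<Rightarrow> 'm" and B :: "'m set"
  assumes "based_module act B"
    and "irreducible_zplus_module act B"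
    and "card B = 5"
  shows "zplus_equivalent act B M51 standard_basis \<or> zplus_equivalent act B M52 standard_basis"
proof -
  interpret M: based_module act B by fact
  have fin: "finite B" using assms(3) card.infinite by fastforce
  \<comment> \<open>The type \<open>5\<close> serves both to index \<open>B\<close> and as the set
    of coordinates of \<open>int^5\<close>.\<close>
  then obtain e :: "5 \<Rightarrow> 'm" where e: "bij_betw e UNIV B"
    using finite_same_card_bij[of "UNIV :: 5 set" B] assms(3) by auto
  have "CARD(5) = 5" by simp
  then obtain p where mat: "rS4_matrices p (\<lambda>b c. M.coeff (V Rho1) (e b) (e c)) (\<lambda>b c. M.coeff (V Rho2) (e b) (e c))"
    and coeffs: "\<And>b c. M.coeff (V Triv) (e b) (e c) = of_bool (b = c)"
      "\<And>b c. M.coeff (V Psi) (e b) (e c) = of_bool (b = p c)"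
      "\<And>b c. M.coeff (V Rho3) (e b) (e c) = M.coeff (V Rho2) (e b) (e (p c))"
    using M.rS4_matrices_coeff[OF assms(2) e] by blast
  interpret rS4_matrices p "\<lambda>b c. M.coeff (V Rho1) (e b) (e c)" "\<lambda>b c. M.coeff (V Rho2) (e b) (e c)"
    by (rule mat)
  show ?thesis
    using classification
  proof cases
    case (triangle b1 b2 b3 b4 b5)
    \<comment> \<open>The map \<open>e \<circ> g\<close> lists the basis in the order that produces
      the matrices of \<open>M51\<close>.\<close>
    define g :: "5 \<Rightarrow> 5" where "g = ($) (vector [b1, b2, b3, b4, b5])"
    have g [simp]: "g 1 = b1" "g 2 = b2" "g 3 = b3" "g 4 = b4" "g 5 = b5"
      by (simp_all add: g_def vector_5)
    have h: "bij_betw (e \<circ> g) UNIV B"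
      unfolding g_def by (rule bij_betw_trans[OF bij_vector_5[OF triangle(1)] e])
    \<comment> \<open>The reversed list supplies the inequations between the \<open>b\<close>'s in
      the opposite orientation.\<close>
    have "\<forall>i j k. M.coeff (V i) ((e \<circ> g) j) ((e \<circ> g) k) = M51 (V i) (axis j 1) $ k"
      using triangle distinct_rev[THEN iffD2, OF triangle(1)]
      unfolding all_irrep all_5 comp_def coeffs
      by (simp add: M51_component vector_5 axis_def)
    moreover have "M51 (of_int n) v = n *s v" for n v
      by (simp add: vec_eq_iff all_5 M51_component vector_5)
    ultimately have "zplus_equivalent act B M51 standard_basis"
      by (intro zplus_equivalent_standard_basis[OF M.zplus_module_axioms _ _ h]
          based_module.axioms(1)[OF based_M51(1)]) simp_all
    then show ?thesis ..
  next
    case (split b1 b2 b3 b4 b5)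
    define g :: "5 \<Rightarrow> 5" where "g = ($) (vector [b1, b2, b3, b4, b5])"
    have g [simp]: "g 1 = b1" "g 2 = b2" "g 3 = b3" "g 4 = b4" "g 5 = b5"
      by (simp_all add: g_def vector_5)
    have h: "bij_betw (e \<circ> g) UNIV B"
      unfolding g_def by (rule bij_betw_trans[OF bij_vector_5[OF split(1)] e])
    have "\<forall>i j k. M.coeff (V i) ((e \<circ> g) j) ((e \<circ> g) k) = M52 (V i) (axis j 1) $ k"
      using split distinct_rev[THEN iffD2, OF split(1)]
      unfolding all_irrep all_5 comp_def coeffs
      by (simp add: M52_component vector_5 axis_def)
    moreover have "M52 (of_int n) v = n *s v" for n v
      by (simp add: vec_eq_iff all_5 M52_component vector_5)
    ultimately have "zplus_equivalent act B M52 standard_basis"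
      by (intro zplus_equivalent_standard_basis[OF M.zplus_module_axioms _ _ h]
          based_module.axioms(1)[OF based_M52(1)]) simp_all
    then show ?thesis ..
  qed
qed

end
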